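(* Let $\rho$ be a positive integer and $b\in\mathbb{Z}_n\setminus\{0\}$. The graph $C_n+\rho\,\{0,b\}$ does not exhibit perfect pair state transfer with respect to the signless Laplacian matrix for $n\ge 16$ whenever $b=\frac n2$, and for $n\ge 22$ whenever $b\ne\frac n2$.
   Context: $C_n$ is the cycle with vertex set $\mathbb{Z}_n$, vertices $i,j$ adjacent (weight 1) iff $i-j\equiv\pm1\pmod n$; $b$ is identified with its representative in $\{1,\dots,n-1\}$. $C_n+\rho\{0,b\}$ is the weighted graph obtained by adding an edge of weight $\rho$ between vertices $0$ and $b$ (if $0,b$ are already adjacent, the weight of that edge becomes $1+\rho$). With $A$ the weighted adjacency matrix and $\Delta$ the diagonal matrix of its row sums, the signless Laplacian is $Q=\Delta+A$. A pair state is a vector $\frac{1}{\sqrt2}(\mathbf{e}_k-\mathbf{e}_l)$ with $k\ne l$ vertices, where $\mathbf{e}_k$ is the characteristic vector of $k$. Perfect pair state transfer with respect to $Q$ means there are two linearly independent pair states $\mathbf{x},\mathbf{y}$, some $\tau>0$ and $\gamma\in\mathbb{C}$ with $\exp(i\tau Q)\mathbf{x}=\gamma\mathbf{y}$. *)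

theory Defs
  imports Complex_Main "HOL-Number_Theory.Cong" "Jordan_Normal_Form.VS_Connect"
begin

text \<open>A weighted graph on the vertex set \<open>{0..<n}\<close> is given by its weight function,
  weight \<open>0\<close> meaning non-adjacency; only its values on \<open>{0..<n}\<close> matter.\<close>

definition cycle_graph :: "nat \<Rightarrow> nat \<Rightarrow> nat \<Rightarrow> real" where
  "cycle_graph n i j =
     (if [int i - int j = 1] (mod int n) \<or> [int i - int j = - 1] (mod int n) then 1 else 0)"

definition add_edge ::
  "(nat \<Rightarrow> nat \<Rightarrow> real) \<Rightarrow> real \<Rightarrow> nat \<Rightarrow> nat \<Rightarrow> (nat \<Rightarrow> nat \<Rightarrow> real)" where
  "add_edge w r u v = (\<lambda>i j. w i j + (if {i, j} = {u, v} then r else 0))"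

definition adjacency_matrix :: "nat \<Rightarrow> (nat \<Rightarrow> nat \<Rightarrow> real) \<Rightarrow> real mat" where
  "adjacency_matrix n w = mat n n (\<lambda>(i, j). w i j)"

definition row_sum_matrix :: "real mat \<Rightarrow> real mat" where
  "row_sum_matrix A = mat_diag (dim_row A) (\<lambda>i. \<Sum>j<dim_col A. A $$ (i, j))"

definition signless_laplacian :: "nat \<Rightarrow> (nat \<Rightarrow> nat \<Rightarrow> real) \<Rightarrow> real mat" where
  "signless_laplacian n w =
     row_sum_matrix (adjacency_matrix n w) + adjacency_matrix n w"

text \<open>The exponential series of a square matrix, summed entrywise. It converges absolutely
  in every entry, so \<open>suminf\<close> is its actual value.\<close>

definition mat_exp :: "complex mat \<Rightarrow> complex mat" where
  "mat_exp M = mat (dim_row M) (dim_row M) (\<lambda>(i, j). \<Sum>m. (M ^\<^sub>m m) $$ (i, j) / fact m)"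

definition pair_state :: "nat \<Rightarrow> nat \<Rightarrow> nat \<Rightarrow> complex vec" where
  "pair_state n k l = complex_of_real (1 / sqrt 2) \<cdot>\<^sub>v (unit_vec n k - unit_vec n l)"

definition is_pair_state :: "nat \<Rightarrow> complex vec \<Rightarrow> bool" where
  "is_pair_state n x \<longleftrightarrow> (\<exists>k<n. \<exists>l<n. k \<noteq> l \<and> x = pair_state n k l)"

text \<open>The library's linear dependence is a property of the set \<open>{x, y}\<close>, which would be
  independent for \<open>x = y \<noteq> 0\<close>; hence the explicit \<open>x \<noteq> y\<close>.\<close>

definition perfect_pair_state_transfer :: "nat \<Rightarrow> real mat \<Rightarrow> bool" where
  "perfect_pair_state_transfer n M \<longleftrightarrow>
     (\<exists>x y \<tau> \<gamma>. is_pair_state n x \<and> is_pair_state n y \<and>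
        x \<noteq> y \<and> \<not> module.lin_dep class_ring (module_vec TYPE(complex) n) {x, y} \<and>
        0 < \<tau> \<and>
        mat_exp ((\<i> * complex_of_real \<tau>) \<cdot>\<^sub>m map_mat complex_of_real M) *\<^sub>v x = \<gamma> \<cdot>\<^sub>v y)"

end

theory Submission
  imports Defs "HOL-Computational_Algebra.Fundamental_Theorem_Algebra" "Jordan_Normal_Form.Char_Poly"
begin

text \<open>
Write \<open>Q\<close> for the signless Laplacian of the cycle with the chord \<open>{0, b}\<close> and \<open>R = Q - 2 I\<close>. The
operator \<open>R\<close> adds up the values at the two neighbours on the cycle and, at the two end points of
the chord (the marks), another \<open>\<rho> * (f 0 + f b)\<close>; passing from \<open>Q\<close> to \<open>R\<close> only multiplies the
transfer by a phase. Let \<open>x = e\<^sub>k - e\<^sub>l\<close> be the transferred state and \<open>T\<close> the set of roots of the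
minimal polynomial of \<open>x\<close> under \<open>R\<close>, that is, the set of eigenvalues of \<open>R\<close> to whose eigenspace
\<open>x\<close> is not orthogonal. Arithmetic shows that \<open>T\<close> is small, geometry that it is large.

\<^bold>\<open>Arithmetic.\<close> Perfect transfer at time \<open>\<tau>\<close> makes all differences of elements of \<open>T\<close> integer multiples
of \<open>\<pi> / \<tau>\<close>, because the transferred state is again a real vector
(\<open>phase_ratio_commensurable\<close>). The minimal polynomial of \<open>x\<close> has rational coefficients, so the sum
of all \<open>(s - t)\<^sup>2\<close> over \<open>T\<close> is rational, and then, by commensurability, so is every single
\<open>(s - t)\<^sup>2\<close>. These numbers are also algebraic integers, hence integers: distinct elements of \<open>T\<close>
are at least 1 apart, and if two of them are less than \<open>4 / 3\<close> apart, then all of \<open>T\<close> consists of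
integers (\<open>transfer_support\<close>). A maximum principle shows that eigenvalues of \<open>R\<close> are at least \<open>-2\<close> and that an eigenvector for an eigenvalue \<open>\<ge> 2\<close> has
constant sign, so that at most one element of \<open>T\<close> is \<open>\<ge> 2\<close>. Hence \<open>T\<close> has at most five elements, at
most four of them in \<open>[-2, 2)\<close>, and if there are four of these, they are \<open>-2, -1, 0, 1\<close>
(\<open>unit_gap_set\<close>).

\<^bold>\<open>Geometry.\<close> For \<open>t \<in> T\<close> the vector \<open>\<Prod>\<^bsub>s \<in> T - {t}\<^esub> (R - s) x\<close> is an eigenvector for \<open>t\<close>, and it vanishes
outside the balls of radius \<open>|T| - 1\<close> around \<open>k\<close> and \<open>l\<close>. Eigenvectors have few zeros: none at all
for an eigenvalue \<open>\<ge> 2\<close> or for \<open>-2\<close>, and never two consecutive ones otherwise. So, unless \<open>T\<close> has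
five elements, each vertex has distance at most 3 from \<open>k\<close> or from \<open>l\<close>. But two balls together
cover no more than two arcs around their centres and a single further arc around one mark
(\<open>two_balls_cover\<close>); for radius 3 these are \<open>7 + 7 + 5 = 19\<close> vertices, and if the chord is a diameter,
they leave a gap already for \<open>n \<ge> 16\<close> (\<open>no_cover_3_3\<close>).

If \<open>T\<close> has five elements, then \<open>T = {-2, -1, 0, 1, m}\<close> with \<open>m \<ge> 2\<close>, and the eigenvector for \<open>m\<close> is
\<open>(R + 2) (R + 1) R (R - 1) x = (R\<^sup>4 + 2 R\<^sup>3 - R\<^sup>2 - 2 R) (e\<^sub>k - e\<^sub>l)\<close>. After exchanging
\<open>k\<close> and \<open>l\<close> if necessary it is positive everywhere.
As \<open>R\<close> has nonnegative entries, the contribution of \<open>- e\<^sub>l\<close> is \<open>\<le> 0\<close> at distance more than 2 from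
\<open>l\<close>, so that the balls of radius 4 around \<open>k\<close> and of radius 2 around \<open>l\<close> cover everything. These have
at most \<open>9 + 5 + 7 = 21\<close> vertices. If the chord is a diameter, the eigenvalue \<open>-2\<close> forces \<open>b\<close> to be
odd and thus \<open>n \<ge> 18\<close>, which again leaves a gap (\<open>no_cover_4_2\<close>).
\<close>

section \<open>The minimal polynomial of a vector under a symmetric matrix\<close>

text \<open>Vectors of length \<open>n\<close> are functions on \<open>nat\<close>, and \<open>L\<close> applies the matrix with entries \<open>A i j\<close>. Since
\<open>L f\<close> is set to 0 from \<open>n\<close> on, a vector that vanishes there is determined by its \<open>n\<close> entries.\<close>

locale symmetric_kernel =
  fixes n :: nat and A :: "nat \<Rightarrow> nat \<Rightarrow> real"
  assumes symm: "\<lbrakk>i < n; j < n\<rbrakk> \<Longrightarrow> A i j = A j i"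
begin

definition L :: "(nat \<Rightarrow> real) \<Rightarrow> nat \<Rightarrow> real" where
  "L f = (\<lambda>i. if i < n then \<Sum>j<n. A i j * f j else 0)"

definition poly_op :: "real poly \<Rightarrow> (nat \<Rightarrow> real) \<Rightarrow> nat \<Rightarrow> real" where
  "poly_op p f = (\<lambda>i. \<Sum>j\<le>degree p. coeff p j * (L ^^ j) f i)"

definition inner_prod :: "(nat \<Rightarrow> real) \<Rightarrow> (nat \<Rightarrow> real) \<Rightarrow> real" where
  "inner_prod f g = (\<Sum>i<n. f i * g i)"

lemma L_sum: "finite S \<Longrightarrow> L (\<lambda>i. \<Sum>s\<in>S. c s * F s i) = (\<lambda>i. \<Sum>s\<in>S. c s * L (F s) i)"
  by (rule ext) (auto simp: L_def sum_distrib_left mult_ac intro: sum.swap)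

lemma L_lin: "L (\<lambda>i. a * f i + c * g i) = (\<lambda>i. a * L f i + c * L g i)"
  by (rule ext) (simp add: L_def sum.distrib sum_distrib_left algebra_simps)

lemma poly_op_bound:
  assumes "degree p \<le> N"
  shows "poly_op p f i = (\<Sum>j\<le>N. coeff p j * (L ^^ j) f i)"
  unfolding poly_op_def using assms
  by (intro sum.mono_neutral_left) (auto simp: coeff_eq_0)

lemma poly_op_0 [simp]: "poly_op 0 f = (\<lambda>i. 0)"
  by (simp add: poly_op_def)

lemma poly_op_pCons: "poly_op (pCons a p) f = (\<lambda>i. a * f i + L (poly_op p f) i)"
proof
  fix i
  have "poly_op (pCons a p) f i = (\<Sum>j\<le>Suc (degree p). coeff (pCons a p) j * (L ^^ j) f i)"
    by (intro poly_op_bound degree_pCons_le)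
  also have "\<dots> = a * f i + (\<Sum>j\<le>degree p. coeff p j * (L ^^ Suc j) f i)"
    by (subst sum.atMost_Suc_shift) simp
  also have "\<dots> = a * f i + L (poly_op p f) i"
    unfolding poly_op_def by (subst L_sum) simp_all
  finally show "poly_op (pCons a p) f i = a * f i + L (poly_op p f) i" .
qed

lemma poly_op_add: "poly_op (p + q) f = (\<lambda>i. poly_op p f i + poly_op q f i)"
proof
  fix i
  let ?N = "max (degree p) (degree q)"
  have "degree (p + q) \<le> ?N" by (rule degree_add_le_max)
  then show "poly_op (p + q) f i = poly_op p f i + poly_op q f i"
    by (simp add: poly_op_bound[where N = ?N] sum.distrib algebra_simps)
qed

lemma poly_op_smult: "poly_op (smult c p) f = (\<lambda>i. c * poly_op p f i)"
  by (rule ext)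
    (simp add: poly_op_bound[where N = "degree p"] degree_smult_le sum_distrib_left mult_ac)

lemma poly_op_diff: "poly_op (p - q) f = (\<lambda>i. poly_op p f i - poly_op q f i)"
  using poly_op_add[of p "- q" f] poly_op_smult[of "-1" q f] by simp

lemma poly_op_mult: "poly_op (p * q) f = poly_op p (poly_op q f)"
proof (induction p)
  case (pCons a p)
  then show ?case by (simp add: poly_op_add poly_op_smult poly_op_pCons)
qed simp

lemma poly_op_1 [simp]: "poly_op 1 f = f"
  by (simp add: poly_op_def)

lemma L_0 [simp]: "L (\<lambda>i. 0) = (\<lambda>i. 0)"
  by (rule ext) (simp add: L_def)

lemma poly_op_linear: "poly_op [:-t, 1:] f = (\<lambda>i. L f i - t * f i)"
  by (simp add: poly_op_pCons)

lemma poly_op_eigen: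
  assumes "L z = (\<lambda>i. t * z i)"
  shows "poly_op p z = (\<lambda>i. poly p t * z i)"
proof (induction p)
  case (pCons a p)
  have "L (\<lambda>i. poly p t * z i) = (\<lambda>i. poly p t * L z i)"
    using L_lin[of "poly p t" z 0 "\<lambda>_. 0"] by simp
  then show ?case by (simp add: poly_op_pCons pCons assms algebra_simps)
qed simp

lemma L_outside: "i \<ge> n \<Longrightarrow> L f i = 0"
  by (simp add: L_def)

lemma poly_op_outside:
  assumes "\<forall>i\<ge>n. f i = 0" and "i \<ge> n"
  shows "poly_op p f i = 0"
  by (cases p) (simp add: poly_op_pCons assms L_outside)

lemma inner_prod_commute: "inner_prod f g = inner_prod g f"
  by (simp add: inner_prod_def mult.commute)

lemma inner_prod_L: "inner_prod (L f) g = inner_prod f (L g)"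
proof -
  have "inner_prod (L f) g = (\<Sum>i<n. \<Sum>j<n. A i j * f j * g i)"
    by (simp add: inner_prod_def L_def sum_distrib_right)
  also have "\<dots> = (\<Sum>j<n. \<Sum>i<n. A i j * f j * g i)"
    by (rule sum.swap)
  also have "\<dots> = (\<Sum>j<n. \<Sum>i<n. f j * (A j i * g i))"
    by (intro sum.cong) (auto simp: symm)
  also have "\<dots> = inner_prod f (L g)"
    by (simp add: inner_prod_def L_def sum_distrib_left)
  finally show ?thesis .
qed

lemma inner_prod_lin: "inner_prod (\<lambda>i. a * f i + c * g i) h = a * inner_prod f h + c * inner_prod g h"
  by (simp add: inner_prod_def sum.distrib sum_distrib_left algebra_simps)

lemma inner_prod_poly_op: "inner_prod (poly_op p f) g = inner_prod f (poly_op p g)"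
proof (induction p arbitrary: f g)
  case 0
  then show ?case by (simp add: inner_prod_def)
next
  case (pCons a p)
  have "poly_op (pCons 0 p) g = poly_op (p * [:0, 1:]) g" by simp
  then have *: "L (poly_op p g) = poly_op p (L g)"
    by (simp only: poly_op_mult) (simp add: poly_op_pCons)
  have "inner_prod (poly_op (pCons a p) f) g = a * inner_prod f g + inner_prod (L (poly_op p f)) g"
    using inner_prod_lin[of a f 1 "L (poly_op p f)" g] by (simp add: poly_op_pCons)
  also have "inner_prod (L (poly_op p f)) g = inner_prod f (L (poly_op p g))"
    by (simp add: inner_prod_L pCons *)
  finally show ?case
    using inner_prod_lin[of a g 1 "L (poly_op p g)" f]
    by (simp add: poly_op_pCons inner_prod_commute[of f])
qed

lemma inner_prod_self_zero:
  assumes "\<forall>i\<ge>n. f i = 0" and "inner_prod f f = 0"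
  shows "f = (\<lambda>i. 0)"
proof
  fix i
  have "\<forall>i\<in>{..<n}. f i * f i = 0"
    using assms(2) unfolding inner_prod_def by (subst (asm) sum_nonneg_eq_0_iff) auto
  then show "f i = 0" using assms(1) by (cases "i < n") auto
qed

lemma eigen_orthogonal:
  assumes "L z = (\<lambda>i. t * z i)" and "L w = (\<lambda>i. s * w i)" and "t \<noteq> s"
  shows "inner_prod z w = 0"
proof -
  have "t * inner_prod z w = s * inner_prod z w"
    using inner_prod_L[of z w] assms(1,2) inner_prod_lin[of t z 0 z w]
      inner_prod_lin[of s w 0 w z]
    by (simp add: inner_prod_commute[of z])
  then show ?thesis using assms(3) by simp
qed

text \<open>The \<open>n + 1\<close> vectors \<open>x, L x, \<dots>, L\<^sup>n x\<close> have only \<open>n\<close> coordinates. A row of zeros makes the matrix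
with these columns square; it is then singular, and a vector in its null space holds the
coefficients of the polynomial.\<close>

lemma ex_annihilating_poly:
  assumes out: "\<forall>i\<ge>n. x i = 0"
  shows "\<exists>p. p \<noteq> 0 \<and> poly_op p x = (\<lambda>i. 0)"
proof -
  define M :: "real mat" where
    "M = mat (Suc n) (Suc n) (\<lambda>(i, j). if i < n then (L ^^ j) x i else 0)"
  have M: "M \<in> carrier_mat (Suc n) (Suc n)" by (simp add: M_def)
  have "M\<^sup>T *\<^sub>v unit_vec (Suc n) n = 0\<^sub>v (Suc n)"
    by (intro eq_vecI) (auto simp: M_def scalar_prod_def unit_vec_def if_distrib[of "\<lambda>u. _ * u"] cong: if_cong)
  moreover have "unit_vec (Suc n) n \<noteq> (0\<^sub>v (Suc n) :: real vec)" by simp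
  ultimately have "det M\<^sup>T = 0"
    using det_0_iff_vec_prod_zero[of "M\<^sup>T" "Suc n"] M by (metis transpose_carrier_mat unit_vec_carrier)
  then have "det M = 0" using det_transpose[OF M] by simp
  then obtain v where v: "v \<in> carrier_vec (Suc n)" "v \<noteq> 0\<^sub>v (Suc n)" "M *\<^sub>v v = 0\<^sub>v (Suc n)"
    using det_0_iff_vec_prod_zero[OF M] by auto
  define p where "p = Poly (list_of_vec v)"
  have cf: "coeff p j = (if j < Suc n then v $ j else 0)" for j
    using v(1) by (auto simp: p_def nth_default_def list_of_vec_index)
  have "p \<noteq> 0"
  proof
    assume "p = 0"
    have "v $ j = 0" if "j < Suc n" for j
      using cf[of j] that \<open>p = 0\<close> by simp
    then have "v = 0\<^sub>v (Suc n)" using v(1) by (intro eq_vecI) auto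
    then show False using v(2) by simp
  qed
  moreover have "poly_op p x i = 0" for i
  proof (cases "i < n")
    case True
    have "degree p \<le> n" by (rule degree_le) (simp add: cf)
    then have "poly_op p x i = (\<Sum>j\<le>n. coeff p j * (L ^^ j) x i)" by (rule poly_op_bound)
    also have "\<dots> = (\<Sum>j\<in>{0..<Suc n}. (L ^^ j) x i * v $ j)"
      by (rule sum.cong) (auto simp: cf)
    also have "\<dots> = (M *\<^sub>v v) $ i"
      using True v(1) by (simp add: M_def scalar_prod_def)
    also have "\<dots> = 0" using v(3) True by simp
    finally show ?thesis .
  next
    case False
    then show ?thesis using out by (intro poly_op_outside) auto
  qed
  ultimately show ?thesis by blast
qed

text \<open>The minimal polynomial relative to the vector \<open>x\<close>. Its roots are the eigenvalues whose eigenspaces are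
not orthogonal to \<open>x\<close>.\<close>

definition min_poly :: "(nat \<Rightarrow> real) \<Rightarrow> real poly \<Rightarrow> bool" where
  "min_poly x f \<longleftrightarrow> lead_coeff f = 1 \<and> poly_op f x = (\<lambda>i. 0) \<and>
     (\<forall>g. g \<noteq> 0 \<longrightarrow> poly_op g x = (\<lambda>i. 0) \<longrightarrow> degree f \<le> degree g)"

lemma ex_min_poly:
  assumes "\<forall>i\<ge>n. x i = 0"
  shows "\<exists>f. min_poly x f"
proof -
  define P where "P p \<longleftrightarrow> p \<noteq> 0 \<and> poly_op p x = (\<lambda>i. 0)" for p
  obtain p0 where "P p0"
    using ex_annihilating_poly[of x] assms unfolding P_def by metis
  from ex_has_least_nat[of P, OF this, of degree] obtain p
    where "P p" and least: "\<And>q. P q \<Longrightarrow> degree p \<le> degree q" by metis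
  then have p: "p \<noteq> 0" "poly_op p x = (\<lambda>i. 0)" unfolding P_def by simp_all
  have mn: "degree p \<le> degree q" if "q \<noteq> 0" "poly_op q x = (\<lambda>i. 0)" for q
    using least[of q] that unfolding P_def by simp
  define f where "f = smult (1 / lead_coeff p) p"
  have "poly_op f x = (\<lambda>i. 0)"
    unfolding f_def poly_op_smult p(2) by simp
  moreover have f: "lead_coeff f = 1" "degree f = degree p"
    using p(1) by (simp_all add: f_def)
  moreover have "degree f \<le> degree q" if "q \<noteq> 0" "poly_op q x = (\<lambda>i. 0)" for q
    unfolding f(2) using that by (rule mn)
  ultimately have "min_poly x f"
    unfolding min_poly_def by (intro conjI allI impI)
  then show ?thesis ..
qed

context
  fixes x f
  assumes out: "\<forall>i\<ge>n. x i = 0" and mp: "min_poly x f"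
begin

lemma min_poly_cofactor_nonzero:
  assumes "f = h * g" and "degree h \<ge> 1"
  shows "poly_op g x \<noteq> (\<lambda>i. 0)"
proof
  assume "poly_op g x = (\<lambda>i. 0)"
  have "f \<noteq> 0" using mp by (auto simp: min_poly_def)
  then have "g \<noteq> 0" "h \<noteq> 0" using assms by auto
  then have "degree f \<le> degree g" using mp \<open>poly_op g x = _\<close> by (auto simp: min_poly_def)
  then show False using assms \<open>g \<noteq> 0\<close> \<open>h \<noteq> 0\<close> by (simp add: degree_mult_eq)
qed

text \<open>If \<open>f = (X - t)\<^sup>2 g\<close>, then \<open>w = (L - t) g(L) x\<close> satisfies
\<open>\<langle>w, w\<rangle> = \<langle>g(L) x, (L - t) w\<rangle> = 0\<close> by symmetry, although \<open>w \<noteq> 0\<close> by minimality.\<close>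

lemma min_poly_no_double_root: "\<not> [:-t, 1:] * [:-t, 1:] dvd f"
proof
  assume "[:-t, 1:] * [:-t, 1:] dvd f"
  then obtain g where "f = [:-t, 1:] * [:-t, 1:] * g" by (rule dvdE)
  then have g: "f = [:-t, 1:] * ([:-t, 1:] * g)" by (simp only: mult.assoc)
  define w where "w = poly_op ([:-t, 1:] * g) x"
  have "poly_op [:-t, 1:] w = (\<lambda>i. 0)"
    using mp unfolding w_def min_poly_def g poly_op_mult by (elim conjE)
  moreover have "inner_prod w w = inner_prod (poly_op [:-t, 1:] (poly_op g x)) w"
    unfolding w_def poly_op_mult ..
  ultimately have "inner_prod w w = inner_prod (poly_op g x) (\<lambda>i. 0)"
    by (simp only: inner_prod_poly_op)
  then have "inner_prod w w = 0" by (simp add: inner_prod_def)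
  then have "w = (\<lambda>i. 0)"
    unfolding w_def using out by (intro inner_prod_self_zero) (auto intro: poly_op_outside)
  moreover have "w \<noteq> (\<lambda>i. 0)" unfolding w_def
    by (rule min_poly_cofactor_nonzero[OF g]) simp
  ultimately show False by simp
qed

text \<open>Take a complex root \<open>z = a + \<i> c\<close>. If \<open>c \<noteq> 0\<close>, then \<open>(X - a)\<^sup>2 + c\<^sup>2\<close> divides the minimal polynomial,
and with \<open>w\<close> the image of \<open>x\<close> under the cofactor symmetry gives
\<open>0 = \<parallel>(L - a) w\<parallel>\<^sup>2 + c\<^sup>2 \<parallel>w\<parallel>\<^sup>2\<close>, which is impossible for \<open>w \<noteq> 0\<close>.\<close>

lemma min_poly_factor_real_root:
  assumes "g dvd f" and "degree g \<ge> 1"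
  shows "\<exists>t. poly g t = 0"
proof -
  have "\<not> constant (poly (map_poly complex_of_real g))"
    using assms(2) by (simp add: constant_degree)
  then obtain z where z: "poly (map_poly complex_of_real g) z = 0"
    using fundamental_theorem_of_algebra by blast
  define a c where "a = Re z" and "c = Im z"
  show ?thesis
  proof (cases "c = 0")
    case True
    then have "z = complex_of_real a" by (simp add: a_def c_def complex_eq_iff)
    then show ?thesis using z by auto
  next
    case False
    define h where "h = [:a\<^sup>2 + c\<^sup>2, - 2 * a, 1:]"
    have hz: "poly (map_poly complex_of_real h) z = 0"
      by (simp add: h_def a_def c_def complex_eq_iff map_poly_pCons algebra_simps power2_eq_square)
    \<comment> \<open>the remainder has degree at most 1 and the root \<open>z\<close>, which is not real\<close>
    define r where "r = g mod h"
    have "poly (map_poly complex_of_real g mod map_poly complex_of_real h) z = 0"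
      using z hz by (simp add: poly_mod)
    then have rz: "poly (map_poly complex_of_real r) z = 0"
      by (simp add: r_def of_real_hom.map_poly_mod)
    have dr: "degree r < 2"
      using degree_mod_less'[of h g] unfolding r_def h_def by (cases "g mod h = 0") (auto simp: h_def)
    define u v where "u = coeff r 0" and "v = coeff r 1"
    have r: "r = [:u, v:]"
      by (rule poly_eqI) (use dr in \<open>auto simp: u_def v_def coeff_pCons coeff_eq_0 split: nat.split\<close>)
    have "v = 0" "u = 0" using rz False
      by (auto simp: r of_real_hom.map_poly_pCons_hom complex_eq_iff c_def)
    then have "h dvd g" using r r_def by auto
    then have "h dvd f" using assms(1) by (rule dvd_trans)
    then obtain q where q: "f = h * q" by (rule dvdE)
    define w where "w = poly_op q x"
    have h2: "h = [:-a, 1:] * [:-a, 1:] + [:c\<^sup>2:]" by (simp add: h_def power2_eq_square)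
    have "poly_op h w = (\<lambda>i. 0)"
      using mp unfolding w_def min_poly_def q poly_op_mult by (elim conjE)
    then have "inner_prod w (poly_op h w) = 0" by (simp add: inner_prod_def)
    moreover have "inner_prod w (poly_op h w) =
       inner_prod (poly_op [:-a, 1:] w) (poly_op [:-a, 1:] w) + c\<^sup>2 * inner_prod w w"
    proof -
      have "poly_op h w = (\<lambda>i. 1 * poly_op [:-a,1:] (poly_op [:-a,1:] w) i + c\<^sup>2 * w i)"
        unfolding h2 poly_op_add poly_op_mult by (simp add: poly_op_pCons[of _ 0])
      then have "inner_prod (poly_op h w) w =
          1 * inner_prod (poly_op [:-a,1:] (poly_op [:-a,1:] w)) w + c\<^sup>2 * inner_prod w w"
        by (simp only: inner_prod_lin)
      then show ?thesis
        unfolding inner_prod_commute[of w "poly_op h w"]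
        by (simp only: inner_prod_poly_op[of _ _ w] mult_1_left)
    qed
    moreover have nonneg: "inner_prod u u \<ge> 0" for u by (simp add: inner_prod_def sum_nonneg)
    ultimately have "c\<^sup>2 * inner_prod w w \<le> 0" using nonneg[of "poly_op [:-a, 1:] w"] by linarith
    then have "inner_prod w w = 0"
      using False nonneg[of w] by (simp add: mult_le_0_iff)
    then have "w = (\<lambda>i. 0)"
      unfolding w_def using out by (intro inner_prod_self_zero) (auto intro: poly_op_outside)
    moreover have "w \<noteq> (\<lambda>i. 0)" unfolding w_def
      by (rule min_poly_cofactor_nonzero[OF q]) (simp add: h_def)
    ultimately show ?thesis by simp
  qed
qed

lemma min_poly_factor_splits:
  assumes "g dvd f" and "lead_coeff g = 1"
  shows "\<exists>T. finite T \<and> g = (\<Prod>t\<in>T. [:-t, 1:])"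
  using assms
proof (induction "degree g" arbitrary: g)
  case 0
  then obtain u where "g = [:u:]" using degree_eq_zeroE by metis
  then have "g = 1" using 0 by (simp add: one_pCons)
  then show ?case by (intro exI[of _ "{}"]) simp
next
  case (Suc d)
  then obtain t where "poly g t = 0" using min_poly_factor_real_root[of g] by auto
  then have "[:-t, 1:] dvd g" by (simp only: poly_eq_0_iff_dvd)
  then obtain h where h: "g = [:-t, 1:] * h" by (rule dvdE)
  have "h \<noteq> 0"
  proof
    assume "h = 0"
    then show False using Suc.hyps(2) h by simp
  qed
  then have "degree g = Suc (degree h)"
    using degree_mult_eq[of "[:-t, 1:]" h] unfolding h by (simp del: mult_pCons_left)
  then have "d = degree h" using Suc.hyps(2) by simp
  moreover have "lead_coeff h = 1"
    using Suc.prems(2) lead_coeff_mult[of "[:-t, 1:]" h] unfolding h by (simp del: mult_pCons_left)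
  moreover have "h dvd f"
    using Suc.prems(1) unfolding h by (rule dvd_mult_right)
  ultimately obtain T where T: "finite T" "h = (\<Prod>t\<in>T. [:-t, 1:])"
    using Suc.hyps(1)[of h] by blast
  have "t \<notin> T"
  proof
    assume "t \<in> T"
    then have "[:-t, 1:] dvd h" unfolding T(2) by (rule dvd_prodI[OF T(1)])
    then have "[:-t, 1:] * [:-t, 1:] dvd g" unfolding h by (rule mult_dvd_mono[OF dvd_refl])
    then show False using dvd_trans[OF _ Suc.prems(1)] min_poly_no_double_root by metis
  qed
  then have "g = (\<Prod>t\<in>insert t T. [:-t, 1:])"
    unfolding h T(2) using T(1) by (simp del: mult_pCons_left)
  then show ?case using T(1) by blast
qed

end

end

section \<open>Rationality of minimal polynomials and of squared differences\<close>

text \<open>A linear retraction of the rational vector space \<open>\<real>\<close> onto \<open>\<rat>\<close>. Applied to the coefficients of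
a linear relation between rational vectors it yields a rational relation.\<close>

lemma ex_rational_projection:
  "\<exists>\<phi> :: real \<Rightarrow> rat. (\<forall>x y. \<phi> (x + y) = \<phi> x + \<phi> y) \<and> (\<forall>q x. \<phi> (of_rat q * x) = q * \<phi> x) \<and> \<phi> 1 = 1"
proof -
  interpret vector_space_pair "(*) :: rat \<Rightarrow> rat \<Rightarrow> rat" "\<lambda>q (x :: real). of_rat q * x"
    by unfold_locales (simp_all add: algebra_simps of_rat_add of_rat_mult)
  have "Vector_Spaces.linear (*) (\<lambda>q (x :: real). of_rat q * x) (of_rat :: rat \<Rightarrow> real)"
    by unfold_locales (simp_all add: of_rat_add of_rat_mult)
  moreover have "inj (of_rat :: rat \<Rightarrow> real)" by (simp add: inj_def)
  ultimately obtain \<phi> :: "real \<Rightarrow> rat" where lin: "Vector_Spaces.linear (\<lambda>q (x :: real). of_rat q * x) (*) \<phi>"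
    and inv: "\<phi> \<circ> of_rat = id"
    using linear_injective_left_inverse by blast
  have "\<phi> 1 = 1" using fun_cong[OF inv, of 1] by simp
  moreover have "\<phi> (x + y) = \<phi> x + \<phi> y" for x y
    using lin unfolding Vector_Spaces.linear_def module_hom_def module_hom_axioms_def by blast
  moreover have "\<phi> (of_rat q * x) = q * \<phi> x" for q x
    using lin unfolding Vector_Spaces.linear_def module_hom_def module_hom_axioms_def by blast
  ultimately show ?thesis by blast
qed

text \<open>The two coefficients after the leading one are Vieta's elementary symmetric functions, written with
power sums. Prefixing zeros by \<open>pCons 0\<close> shifts the index up, so that \<open>card T - 1\<close> and \<open>card T - 2\<close>
need not be truncated and the formulas hold for sets with fewer than two elements too.\<close>

lemma coeffs_prod_linear:
  fixes T :: "real set"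
  assumes "finite T"
  defines "p \<equiv> \<Prod>t\<in>T. [:-t, 1:]"
  shows "degree p = card T"
    and "coeff (pCons 0 p) (card T) = - (\<Sum>t\<in>T. t)"
    and "2 * coeff (pCons 0 (pCons 0 p)) (card T) = (\<Sum>t\<in>T. t)\<^sup>2 - (\<Sum>t\<in>T. t\<^sup>2)"
proof -
  have "degree p = card T \<and> coeff p (card T) = 1 \<and>
      coeff (pCons 0 p) (card T) = - (\<Sum>t\<in>T. t) \<and>
      2 * coeff (pCons 0 (pCons 0 p)) (card T) = (\<Sum>t\<in>T. t)\<^sup>2 - (\<Sum>t\<in>T. t\<^sup>2)"
    unfolding p_def using assms(1)
  proof (induction T)
    case (insert t T)
    let ?q = "\<Prod>t\<in>T. [:-t, 1:]"
    have q: "(\<Prod>t\<in>insert t T. [:-t, 1:]) = pCons 0 ?q - smult t ?q"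
      using insert.hyps by (simp add: algebra_simps)
    have pc: "coeff (pCons 0 (pCons 0 ?q - smult t ?q)) m =
        coeff (pCons 0 (pCons 0 ?q)) m - t * coeff (pCons 0 ?q) m" for m
      by (cases m) simp_all
    have c: "card (insert t T) = Suc (card T)" using insert.hyps by simp
    have "?q \<noteq> 0" using insert.hyps(1) by simp
    then have "degree (\<Prod>t\<in>insert t T. [:-t, 1:]) = Suc (card T)"
      using insert by (simp add: degree_mult_eq del: mult_pCons_left)
    then show ?case
      using insert unfolding c q
      by (simp add: pc coeff_eq_0 power2_eq_square algebra_simps)
  qed simp
  then show "degree p = card T"
    "coeff (pCons 0 p) (card T) = - (\<Sum>t\<in>T. t)"
    "2 * coeff (pCons 0 (pCons 0 p)) (card T) = (\<Sum>t\<in>T. t)\<^sup>2 - (\<Sum>t\<in>T. t\<^sup>2)" by blast+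
qed

lemma rational_power_sums:
  fixes T :: "real set"
  assumes "finite T" and "\<And>j. coeff (\<Prod>t\<in>T. [:-t, 1:]) j \<in> \<rat>"
  shows "(\<Sum>t\<in>T. t) \<in> \<rat>" and "(\<Sum>t\<in>T. t\<^sup>2) \<in> \<rat>"
proof -
  let ?p = "\<Prod>t\<in>T. [:-t, 1:]"
  have c: "coeff (pCons 0 q) j \<in> \<rat>" if "\<And>j. coeff q j \<in> \<rat>" for q :: "real poly" and j
    using that by (simp add: coeff_pCons split: nat.split)
  have "- (\<Sum>t\<in>T. t) \<in> \<rat>"
    unfolding coeffs_prod_linear(2)[OF assms(1), symmetric] by (intro c assms(2))
  then show s: "(\<Sum>t\<in>T. t) \<in> \<rat>" by simp
  have "2 * coeff (pCons 0 (pCons 0 ?p)) (card T) \<in> \<rat>"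
    by (intro Rats_mult c assms(2)) simp
  then have "(\<Sum>t\<in>T. t)\<^sup>2 - 2 * coeff (pCons 0 (pCons 0 ?p)) (card T) \<in> \<rat>"
    by (intro Rats_diff Rats_power s)
  then show "(\<Sum>t\<in>T. t\<^sup>2) \<in> \<rat>"
    unfolding coeffs_prod_linear(3)[OF assms(1)] by simp
qed

text \<open>The sum of all squared differences is a rational combination of the two power sums. It is also
\<open>K \<delta>\<^sup>2\<close> with a positive integer \<open>K\<close>, so \<open>\<delta>\<^sup>2\<close> is rational, and every squared difference is an integer
multiple of \<open>\<delta>\<^sup>2\<close>.\<close>

lemma commensurable_gap_square_rational:
  fixes T :: "real set"
  assumes T: "finite T" and s: "(\<Sum>t\<in>T. t) \<in> \<rat>" and s2: "(\<Sum>t\<in>T. t\<^sup>2) \<in> \<rat>"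
    and comm: "\<And>s t. s \<in> T \<Longrightarrow> t \<in> T \<Longrightarrow> \<exists>k::int. s - t = of_int k * \<delta>"
    and "a \<in> T" "c \<in> T"
  shows "(a - c)\<^sup>2 \<in> \<rat>"
proof (cases "a = c")
  case False
  obtain k where k: "\<And>s t. s \<in> T \<Longrightarrow> t \<in> T \<Longrightarrow> s - t = of_int (k s t) * \<delta>"
    using comm by metis
  define K where "K = (\<Sum>s\<in>T. \<Sum>t\<in>T. (k s t)\<^sup>2)"
  have "(\<Sum>s\<in>T. \<Sum>t\<in>T. (s - t)\<^sup>2) = 2 * of_nat (card T) * (\<Sum>t\<in>T. t\<^sup>2) - 2 * (\<Sum>t\<in>T. t)\<^sup>2"
  proof -
    have "(\<Sum>s\<in>T. \<Sum>t\<in>T. (s - t)\<^sup>2) =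
        (\<Sum>s\<in>T. of_nat (card T) * s\<^sup>2 + (\<Sum>t\<in>T. t\<^sup>2) - 2 * (\<Sum>t\<in>T. t) * s)"
      by (intro sum.cong refl) (simp add: power2_diff sum.distrib sum_subtractf sum_distrib_left sum_distrib_right mult_ac)
    also have "\<dots> = of_nat (card T) * (\<Sum>t\<in>T. t\<^sup>2) + of_nat (card T) * (\<Sum>t\<in>T. t\<^sup>2)
        - 2 * (\<Sum>t\<in>T. t) * (\<Sum>t\<in>T. t)"
      by (simp add: sum.distrib sum_subtractf sum_distrib_left)
    finally show ?thesis by (simp add: power2_eq_square)
  qed
  then have D: "(\<Sum>s\<in>T. \<Sum>t\<in>T. (s - t)\<^sup>2) \<in> \<rat>"
    using s s2 by simp
  have "(\<Sum>s\<in>T. \<Sum>t\<in>T. (s - t)\<^sup>2) = of_int K * \<delta>\<^sup>2"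
    using k by (simp add: K_def power_mult_distrib sum_distrib_right)
  moreover have "0 < K"
  proof -
    have "k a c \<noteq> 0" using k[of a c] assms(5,6) False by auto
    then have "0 < (k a c)\<^sup>2" by simp
    also have "(k a c)\<^sup>2 \<le> (\<Sum>t\<in>T. (k a t)\<^sup>2)"
      using T assms(6) by (intro member_le_sum) auto
    also have "\<dots> \<le> K" unfolding K_def
      using T assms(5) by (intro member_le_sum[of a T "\<lambda>s. \<Sum>t\<in>T. (k s t)\<^sup>2"] sum_nonneg) auto
    finally show ?thesis .
  qed
  ultimately have "\<delta>\<^sup>2 = (\<Sum>s\<in>T. \<Sum>t\<in>T. (s - t)\<^sup>2) / of_int K" by simp
  then have "\<delta>\<^sup>2 \<in> \<rat>" using D by simp
  then show ?thesis using k[OF assms(5,6)] by (simp add: power_mult_distrib)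
qed simp

section \<open>Eigenvalues of integer matrices as algebraic integers\<close>

lemma integer_matrix_eigenvalue_algebraic_int:
  fixes M :: "real mat"
  assumes M: "M \<in> carrier_mat N N" and int: "\<And>i j. i < N \<Longrightarrow> j < N \<Longrightarrow> M $$ (i, j) \<in> \<int>"
    and v: "v \<in> carrier_vec N" "v \<noteq> 0\<^sub>v N" "M *\<^sub>v v = c \<cdot>\<^sub>v v"
  shows "algebraic_int c"
proof -
  define M' :: "int mat" where "M' = mat N N (\<lambda>(i, j). \<lfloor>M $$ (i, j)\<rfloor>)"
  have M': "M' \<in> carrier_mat N N" by (simp add: M'_def)
  have MM: "M = map_mat of_int M'"
    using M int by (intro eq_matI) (auto simp: M'_def)
  have "eigenvalue M c"
    unfolding eigenvalue_def eigenvector_def using M v by auto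
  then have "poly (char_poly M) c = 0"
    using eigenvalue_root_char_poly[OF M] by simp
  then have "poly (map_poly of_int (char_poly M')) c = 0"
    unfolding MM of_int_hom.char_poly_hom[OF M'] .
  moreover have "lead_coeff (char_poly M') = 1"
    using degree_monic_char_poly[OF M'] by simp
  ultimately show ?thesis unfolding algebraic_int_altdef_ipoly by blast
qed

text \<open>Pairs of indices below \<open>n\<close> are encoded as single indices below \<open>n * n\<close>, for tensor products.\<close>

lemma sum_div_mod:
  fixes g :: "nat \<Rightarrow> nat \<Rightarrow> 'a :: comm_monoid_add"
  shows "(\<Sum>i<n * n. g (i div n) (i mod n)) = (\<Sum>a<n. \<Sum>c<n. g a c)"
proof -
  have "(\<Sum>a<n. \<Sum>c<n. g a c) = (\<Sum>(a, c)\<in>{..<n} \<times> {..<n}. g a c)"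
    by (rule sum.cartesian_product)
  also have "\<dots> = (\<Sum>i<n * n. g (i div n) (i mod n))"
  proof (rule sum.reindex_bij_witness[of _ "\<lambda>i. (i div n, i mod n)" "\<lambda>(a, c). a * n + c"], goal_cases)
    case (2 p)
    obtain a c where p: "p = (a, c)" by (cases p)
    then have ac: "a < n" "c < n" using 2 by auto
    have "a * n + c < Suc a * n" using ac by simp
    also have "\<dots> \<le> n * n" using ac by (intro mult_right_mono) auto
    finally show ?case using p by simp
  next
    case (4 i)
    then have "n > 0" by (cases n) auto
    then show ?case using 4 by (auto simp: less_mult_imp_div_less)
  qed auto
  finally show ?thesis ..
qed

section \<open>The eigenvalue support of a state with perfect transfer\<close>

text \<open>Applied to \<open>x\<close>, with \<open>T\<close> the roots of its minimal polynomial, this extracts a nonzero multiple of the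
component of \<open>x\<close> in the eigenspace of \<open>t\<close>.\<close>

definition omit_root :: "real set \<Rightarrow> real \<Rightarrow> real poly" where
  "omit_root T t = (\<Prod>s\<in>T - {t}. [:-s, 1:])"

context symmetric_kernel
begin

text \<open>The retraction onto \<open>\<rat>\<close> turns the minimal polynomial into another monic polynomial of the same degree
that annihilates \<open>x\<close>, and there is only one.\<close>

lemma min_poly_rational:
  assumes out: "\<forall>i\<ge>n. x i = 0" and mp: "min_poly x f"
    and A: "\<And>i j. i < n \<Longrightarrow> j < n \<Longrightarrow> A i j \<in> \<rat>" and x: "\<And>i. x i \<in> \<rat>"
  shows "coeff f j \<in> \<rat>"
proof -
  obtain \<phi> :: "real \<Rightarrow> rat" where add: "\<And>x y. \<phi> (x + y) = \<phi> x + \<phi> y"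
    and mult: "\<And>q x. \<phi> (of_rat q * x) = q * \<phi> x" and one: "\<phi> 1 = 1"
    using ex_rational_projection by blast
  have zero: "\<phi> 0 = 0" using add[of 0 0] by simp
  have sum: "\<phi> (\<Sum>s\<in>S. h s) = (\<Sum>s\<in>S. \<phi> (h s))" if "finite S" for h :: "nat \<Rightarrow> real" and S
    using that by (induction S) (simp_all add: zero add)
  have Rj: "(L ^^ j) x i \<in> \<rat>" for i j
    by (induction j arbitrary: i) (auto simp: x L_def A intro!: Rats_sum Rats_mult)
  define g where "g = map_poly (\<lambda>c. of_rat (\<phi> c) :: real) f"
  have cg: "coeff g j = of_rat (\<phi> (coeff f j))" for j
    by (simp add: g_def coeff_map_poly zero)
  have dg: "degree g \<le> degree f" unfolding g_def by (rule degree_map_poly_le)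
  have "poly_op g x i = 0" for i
  proof -
    have "\<forall>j. \<exists>q. (L ^^ j) x i = of_rat q" 
    proof
      fix j
      show "\<exists>q. (L ^^ j) x i = of_rat q" using Rj[of j i] by (rule Rats_cases) blast
    qed
    then obtain r where r: "\<And>j. (L ^^ j) x i = of_rat (r j)" by (elim choice[elim_format] exE) blast
    have "0 = poly_op f x i" using mp by (simp add: min_poly_def)
    also have "\<dots> = (\<Sum>j\<le>degree f. of_rat (r j) * coeff f j)"
      by (simp add: poly_op_def r mult.commute)
    finally have "(0 :: real) = of_rat (\<phi> (\<Sum>j\<le>degree f. of_rat (r j) * coeff f j))"
      using zero by (simp only: of_rat_0)
    also have "\<dots> = (\<Sum>j\<le>degree f. coeff g j * (L ^^ j) x i)"
      by (simp add: sum mult cg r of_rat_sum of_rat_mult) (simp add: mult.commute)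
    also have "\<dots> = poly_op g x i" by (rule poly_op_bound[OF dg, symmetric])
    finally show ?thesis by simp
  qed
  then have "poly_op (f - g) x = (\<lambda>i. 0)"
    using mp by (intro ext) (simp add: poly_op_diff min_poly_def)
  then have "f - g = 0 \<or> degree f \<le> degree (f - g)"
    using mp unfolding min_poly_def by blast
  moreover have "degree (f - g) < degree f" if "f - g \<noteq> 0"
  proof -
    have "coeff (f - g) (degree f) = 0"
      using mp by (simp add: cg min_poly_def one)
    moreover have "degree (f - g) \<le> degree f" using dg by (intro degree_diff_le) auto
    moreover have "coeff (f - g) (degree (f - g)) \<noteq> 0"
      by (rule leading_coeff_neq_0[OF that])
    ultimately show ?thesis by (cases "degree (f - g) = degree f") auto
  qed
  ultimately have "f = g" by fastforce
  then have "coeff f j = of_rat (\<phi> (coeff f j))" using cg[of j] by simp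
  also have "\<dots> \<in> \<rat>" by simp
  finally show ?thesis .
qed

lemma eigenvalue_algebraic_int:
  assumes A: "\<And>i j. i < n \<Longrightarrow> j < n \<Longrightarrow> A i j \<in> \<int>"
    and z: "L z = (\<lambda>i. t * z i)" "i < n" "z i \<noteq> 0"
  shows "algebraic_int t"
proof (rule integer_matrix_eigenvalue_algebraic_int)
  show "mat n n (\<lambda>(i, j). A i j) \<in> carrier_mat n n" "vec n z \<in> carrier_vec n" by simp_all
  show "mat n n (\<lambda>(i, j). A i j) $$ (i, j) \<in> \<int>" if "i < n" "j < n" for i j
    using A[OF that] that by simp
  show "vec n z \<noteq> 0\<^sub>v n"
  proof
    assume "vec n z = 0\<^sub>v n"
    then have "vec n z $ i = 0\<^sub>v n $ i" by simp
    then show False using z(2,3) by simp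
  qed
  show "mat n n (\<lambda>(i, j). A i j) *\<^sub>v vec n z = t \<cdot>\<^sub>v vec n z"
  proof (rule eq_vecI)
    fix i assume "i < dim_vec (t \<cdot>\<^sub>v vec n z)"
    then show "(mat n n (\<lambda>(i, j). A i j) *\<^sub>v vec n z) $ i = (t \<cdot>\<^sub>v vec n z) $ i"
      using fun_cong[OF z(1), of i] by (simp add: L_def scalar_prod_def atLeast0LessThan)
  qed simp
qed

text \<open>The difference \<open>t - s\<close> is an eigenvalue of \<open>B = A \<otimes> I - I \<otimes> A\<close> with eigenvector \<open>z \<otimes> w\<close>, so its
square is an eigenvalue of the integer matrix \<open>B * B\<close>.\<close>

lemma gap_square_algebraic_int:
  assumes A: "\<And>i j. i < n \<Longrightarrow> j < n \<Longrightarrow> A i j \<in> \<int>"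
    and z: "L z = (\<lambda>i. t * z i)" "i0 < n" "z i0 \<noteq> 0"
    and w: "L w = (\<lambda>i. s * w i)" "j0 < n" "w j0 \<noteq> 0"
  shows "algebraic_int ((t - s)\<^sup>2)"
proof -
  define B where "B = mat (n * n) (n * n) (\<lambda>(i, j).
      (if i mod n = j mod n then A (i div n) (j div n) else 0) -
      (if i div n = j div n then A (i mod n) (j mod n) else 0))"
  define v where "v = vec (n * n) (\<lambda>i. z (i div n) * w (i mod n))"
  have B: "B \<in> carrier_mat (n * n) (n * n)" and v: "v \<in> carrier_vec (n * n)"
    by (simp_all add: B_def v_def)
  have n: "n > 0" using z(2) by simp
  have dm: "i div n < n" "i mod n < n" if "i < n * n" for i
    using that n by (simp_all add: less_mult_imp_div_less)
  have Bv: "B *\<^sub>v v = (t - s) \<cdot>\<^sub>v v"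
  proof (rule eq_vecI)
    fix i assume "i < dim_vec ((t - s) \<cdot>\<^sub>v v)"
    then have i: "i < n * n" by (simp add: v_def)
    define a c where "a = i div n" and "c = i mod n"
    have ac: "a < n" "c < n" using dm[OF i] by (simp_all add: a_def c_def)
    have "(B *\<^sub>v v) $ i = (\<Sum>j<n * n. ((if c = j mod n then A a (j div n) else 0) -
        (if a = j div n then A c (j mod n) else 0)) * (z (j div n) * w (j mod n)))"
      unfolding a_def c_def using i by (simp add: B_def v_def scalar_prod_def atLeast0LessThan)
    also have "\<dots> = (\<Sum>k<n. \<Sum>l<n. ((if c = l then A a k else 0) - (if a = k then A c l else 0)) * (z k * w l))"
      by (rule sum_div_mod)
    also have "\<dots> = (\<Sum>k<n. \<Sum>l<n. if c = l then A a k * z k * w l else 0)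
        - (\<Sum>k<n. \<Sum>l<n. if a = k then A c l * w l * z k else 0)"
      unfolding sum_subtractf[symmetric] by (intro sum.cong refl) (auto simp: algebra_simps)
    also have "(\<Sum>k<n. \<Sum>l<n. if c = l then A a k * z k * w l else 0) = L z a * w c"
      using ac by (simp add: L_def sum_distrib_right)
    also have "(\<Sum>k<n. \<Sum>l<n. if a = k then A c l * w l * z k else 0) = (\<Sum>k<n. if a = k then L w c * z k else 0)"
      using ac by (intro sum.cong) (auto simp: L_def sum_distrib_right)
    also have "\<dots> = L w c * z a" using ac by simp
    finally show "(B *\<^sub>v v) $ i = ((t - s) \<cdot>\<^sub>v v) $ i"
      using i by (simp add: z(1) w(1) v_def a_def c_def algebra_simps)
  qed (simp add: B_def v_def)
  show ?thesis
  proof (rule integer_matrix_eigenvalue_algebraic_int)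
    show "B * B \<in> carrier_mat (n * n) (n * n)" using B by simp
    show "v \<in> carrier_vec (n * n)" by (fact v)
    show "(B * B) $$ (i, j) \<in> \<int>" if "i < n * n" "j < n * n" for i j
    proof -
      have Bint: "B $$ (k, l) \<in> \<int>" if kl: "k < n * n" "l < n * n" for k l
      proof -
        have "A (k div n) (l div n) \<in> \<int>" "A (k mod n) (l mod n) \<in> \<int>"
          using A dm kl by blast+
        then show ?thesis using kl by (simp add: B_def)
      qed
      have "(B * B) $$ (i, j) = (\<Sum>k<n * n. B $$ (i, k) * B $$ (k, j))"
        using that B by (simp add: scalar_prod_def atLeast0LessThan)
      also have "\<dots> \<in> \<int>"
        using that by (intro Ints_sum Ints_mult Bint) simp_all
      finally show ?thesis .
    qed
    show "v \<noteq> 0\<^sub>v (n * n)"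
    proof
      have "i0 * n + j0 < Suc i0 * n" using w(2) by simp
      also have "\<dots> \<le> n * n" using z(2) by (intro mult_right_mono) auto
      finally have lt: "i0 * n + j0 < n * n" .
      have "v $ (i0 * n + j0) = z ((i0 * n + j0) div n) * w ((i0 * n + j0) mod n)"
        unfolding v_def by (rule index_vec[OF lt])
      also have "\<dots> = z i0 * w j0" using w(2) by simp
      also have "\<dots> \<noteq> 0" using z(3) w(3) by simp
      finally have "v $ (i0 * n + j0) \<noteq> 0" .
      moreover assume "v = 0\<^sub>v (n * n)"
      ultimately show False using index_zero_vec(1)[OF lt] by metis
    qed
    have "(B * B) *\<^sub>v v = B *\<^sub>v (B *\<^sub>v v)" by (rule assoc_mult_mat_vec[OF B B v])
    also have "\<dots> = (t - s) \<cdot>\<^sub>v (B *\<^sub>v v)" by (simp only: Bv mult_mat_vec[OF B v])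
    finally show "(B * B) *\<^sub>v v = (t - s)\<^sup>2 \<cdot>\<^sub>v v"
      unfolding Bv by (simp add: smult_smult_assoc power2_eq_square)
  qed
qed

text \<open>The last claim follows from
\<open>\<langle>z, z\<rangle> = \<langle>x, p(L) z\<rangle> = p(t) \<langle>x, z\<rangle>\<close> with \<open>p = omit_root T t\<close>.\<close>

lemma min_poly_cofactor_eigen:
  assumes out: "\<forall>i\<ge>n. x i = 0" and T: "finite T"
    and mp: "min_poly x (\<Prod>s\<in>T. [:-s, 1:])" and t: "t \<in> T"
  defines "z \<equiv> poly_op (omit_root T t) x"
  shows "L z = (\<lambda>i. t * z i)" and "\<exists>i<n. z i \<noteq> 0" and "inner_prod z x \<noteq> 0"
proof -
  have f: "(\<Prod>s\<in>T. [:-s, 1:]) = [:-t, 1:] * omit_root T t"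
    unfolding omit_root_def by (rule prod.remove[OF T t])
  have "(\<lambda>i. L z i - t * z i) = (\<lambda>i. 0)"
    using mp unfolding min_poly_def f poly_op_mult poly_op_linear z_def by (elim conjE)
  then have "L z i - t * z i = 0" for i by (rule fun_cong)
  then show Lz: "L z = (\<lambda>i. t * z i)" by (intro ext) simp
  have nz: "z \<noteq> (\<lambda>i. 0)"
    unfolding z_def by (rule min_poly_cofactor_nonzero[of x, OF out mp f]) simp_all
  have zout: "\<forall>i\<ge>n. z i = 0"
    unfolding z_def using poly_op_outside[OF out] by blast
  show "\<exists>i<n. z i \<noteq> 0"
  proof (rule ccontr)
    assume "\<not> (\<exists>i<n. z i \<noteq> 0)"
    then have "z i = 0" for i using zout by (cases "i < n") auto
    then show False using nz by blast
  qed
  have "inner_prod z z = inner_prod x (poly_op (omit_root T t) z)"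
    unfolding z_def by (rule inner_prod_poly_op)
  also have "\<dots> = poly (omit_root T t) t * inner_prod z x"
    unfolding poly_op_eigen[OF Lz] using inner_prod_lin[of "poly (omit_root T t) t" z 0 z x]
    by (simp add: inner_prod_commute[of x])
  finally have "inner_prod z z = poly (omit_root T t) t * inner_prod z x" .
  moreover have "inner_prod z z \<noteq> 0" using inner_prod_self_zero[of z, OF zout] nz by blast
  ultimately show "inner_prod z x \<noteq> 0" by auto
qed

text \<open>The quotient of the two phases is real, so the angle between them is a multiple of \<open>\<pi>\<close>.\<close>

lemma phase_ratio_commensurable:
  fixes a a' c c' \<tau> s t :: real and \<gamma> :: complex
  assumes "cis (\<tau> * t) * of_real a = \<gamma> * of_real a'" "cis (\<tau> * s) * of_real c = \<gamma> * of_real c'"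
    and "a \<noteq> 0" "c \<noteq> 0" "\<tau> > 0"
  shows "\<exists>k::int. t - s = of_int k * (pi / \<tau>)"
proof -
  have "\<gamma> \<noteq> 0" "a' \<noteq> 0" "c' \<noteq> 0" using assms by auto
  have "cis (\<tau> * t) = \<gamma> * of_real (a' / a)" "cis (\<tau> * s) = \<gamma> * of_real (c' / c)"
    using assms by (simp_all add: field_simps)
  then have "cis (\<tau> * t) / cis (\<tau> * s) = of_real ((a' / a) / (c' / c))"
    using \<open>\<gamma> \<noteq> 0\<close> by simp
  then have "cis (\<tau> * t - \<tau> * s) = of_real ((a' / a) / (c' / c))"
    by (simp only: cis_divide)
  then have "Im (cis (\<tau> * t - \<tau> * s)) = 0" by (simp only: Im_complex_of_real)
  then have "sin (\<tau> * t - \<tau> * s) = 0" by simp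
  then obtain k :: int where "\<tau> * t - \<tau> * s = of_int k * pi"
    unfolding sin_zero_iff_int2 by blast
  then have "t - s = of_int k * (pi / \<tau>)" using assms(5) by (simp add: field_simps)
  then show ?thesis ..
qed

text \<open>The hypothesis \<open>transfer\<close> is what perfect transfer from \<open>x\<close> to the real vector \<open>y\<close> at time \<open>\<tau>\<close> means
in terms of eigenvectors. A squared gap is a rational algebraic integer. If a gap lies in
\<open>[1, 4/3)\<close>, its square is an integer below 2, so the gap is 1; then \<open>\<pi> / \<tau>\<close> is rational, all
differences are rational, and since the sum over \<open>T\<close> is rational, so are the elements of \<open>T\<close>.\<close>

theorem transfer_support:
  fixes \<gamma> :: complex
  assumes A: "\<And>i j. i < n \<Longrightarrow> j < n \<Longrightarrow> A i j \<in> \<int>"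
    and out: "\<forall>i\<ge>n. x i = 0" and x: "\<And>i. x i \<in> \<int>"
    and "\<tau> > 0"
    and transfer: "\<And>t z. L z = (\<lambda>i. t * z i) \<Longrightarrow>
      cis (\<tau> * t) * of_real (inner_prod z x) = \<gamma> * of_real (inner_prod z y)"
  obtains T where "finite T" "min_poly x (\<Prod>s\<in>T. [:-s, 1:])"
    "\<And>s t. s \<in> T \<Longrightarrow> t \<in> T \<Longrightarrow> s \<noteq> t \<Longrightarrow> 1 \<le> \<bar>s - t\<bar>"
    "\<And>s t. s \<in> T \<Longrightarrow> t \<in> T \<Longrightarrow> s \<noteq> t \<Longrightarrow> \<bar>s - t\<bar> < 4 / 3 \<Longrightarrow> T \<subseteq> \<int>"
proof -
  obtain f where f: "min_poly x f" using ex_min_poly[of x] out by blast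
  then have "lead_coeff f = 1" by (simp add: min_poly_def)
  then obtain T where T: "finite T" and fT: "f = (\<Prod>s\<in>T. [:-s, 1:])"
    using min_poly_factor_splits[of x, OF out f dvd_refl] by blast
  have mp: "min_poly x (\<Prod>s\<in>T. [:-s, 1:])" using f unfolding fT .
  note eig = min_poly_cofactor_eigen[of x T, OF out T mp]
  have rat: "coeff (\<Prod>s\<in>T. [:-s, 1:]) j \<in> \<rat>" for j
    using A x by (intro min_poly_rational[of x, OF out mp]) (auto intro: subsetD[OF Ints_subset_Rats])
  have sum: "(\<Sum>t\<in>T. t) \<in> \<rat>" and sum2: "(\<Sum>t\<in>T. t\<^sup>2) \<in> \<rat>"
    using rational_power_sums[OF T rat] by blast+
  have comm: "\<exists>k::int. s - t = of_int k * (pi / \<tau>)" if "s \<in> T" "t \<in> T" for s t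
    using phase_ratio_commensurable[OF transfer[OF eig(1)[OF that(1)]] transfer[OF eig(1)[OF that(2)]]
        eig(3)[OF that(1)] eig(3)[OF that(2)] \<open>\<tau> > 0\<close>] .
  have gap_int: "(s - t)\<^sup>2 \<in> \<int>" if st: "s \<in> T" "t \<in> T" for s t
  proof (rule rational_algebraic_int_is_int)
    show "(s - t)\<^sup>2 \<in> \<rat>"
      by (rule commensurable_gap_square_rational[OF T sum sum2 comm st])
    obtain i j where "i < n" "poly_op (omit_root T s) x i \<noteq> 0" "j < n" "poly_op (omit_root T t) x j \<noteq> 0"
      using eig(2)[OF st(1)] eig(2)[OF st(2)] by blast
    then show "algebraic_int ((s - t)\<^sup>2)"
      using gap_square_algebraic_int[OF A eig(1)[OF st(1)] _ _ eig(1)[OF st(2)]] by blast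
  qed
  have gap: "1 \<le> \<bar>s - t\<bar>" if st: "s \<in> T" "t \<in> T" "s \<noteq> t" for s t
  proof -
    obtain m where m: "(s - t)\<^sup>2 = of_int m" using gap_int[OF st(1,2)] by (rule Ints_cases)
    have "0 < (s - t)\<^sup>2" using st(3) by simp
    then have "1 \<le> (s - t)\<^sup>2" unfolding m by simp
    then show ?thesis using abs_le_square_iff[of 1 "s - t"] by simp
  qed
  have "T \<subseteq> \<int>" if st: "s \<in> T" "t \<in> T" "s \<noteq> t" and lt: "\<bar>s - t\<bar> < 4 / 3" for s t
  proof
    obtain m where m: "(s - t)\<^sup>2 = of_int m" using gap_int[OF st(1,2)] by (rule Ints_cases)
    have "\<bar>s - t\<bar>\<^sup>2 < (4 / 3)\<^sup>2" using lt by (intro power_strict_mono) auto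
    then have "(s - t)\<^sup>2 < 2" by (simp add: power2_eq_square)
    moreover have "0 < (s - t)\<^sup>2" using st(3) by simp
    ultimately have "m = 1" unfolding m by linarith
    then have unit: "s - t = 1 \<or> s - t = -1" using m by (simp add: power2_eq_1_iff)
    obtain k :: int where k: "s - t = of_int k * (pi / \<tau>)" using comm[OF st(1,2)] by blast
    then have "k \<noteq> 0" using unit by auto
    then have "pi / \<tau> = (s - t) / of_int k" using k by (simp add: field_simps)
    moreover have "s - t \<in> \<rat>" using unit by auto
    ultimately have delta: "pi / \<tau> \<in> \<rat>" by simp
    fix u assume u: "u \<in> T"
    have diff: "u - v \<in> \<rat>" if v: "v \<in> T" for v
    proof -
      obtain k :: int where k: "u - v = of_int k * (pi / \<tau>)" using comm[OF u v] by blast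
      show ?thesis unfolding k by (rule Rats_mult[OF _ delta]) simp
    qed
    have "of_nat (card T) * u = (\<Sum>v\<in>T. u - v) + (\<Sum>v\<in>T. v)"
      by (simp add: sum_subtractf)
    also have "\<dots> \<in> \<rat>" by (intro Rats_add Rats_sum diff sum)
    finally have cu: "of_nat (card T) * u \<in> \<rat>" .
    have "card T \<noteq> 0" using u T by auto
    then have "u = of_nat (card T) * u / of_nat (card T)" by simp
    also have "\<dots> \<in> \<rat>" by (rule Rats_divide[OF cu]) simp
    finally have "u \<in> \<rat>" .
    moreover obtain i where "i < n" "poly_op (omit_root T u) x i \<noteq> 0" using eig(2)[OF u] by blast
    then have "algebraic_int u" using eigenvalue_algebraic_int[OF A eig(1)[OF u]] by blast
    ultimately show "u \<in> \<int>" by (intro rational_algebraic_int_is_int)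
  qed
  then show ?thesis using that[OF T mp gap] by blast
qed

end

section \<open>A cycle with a chord\<close>

definition delta :: "nat \<Rightarrow> nat \<Rightarrow> real" where
  "delta k i = (if i = k then 1 else 0)"

definition pair_vec :: "nat \<Rightarrow> nat \<Rightarrow> nat \<Rightarrow> real" where
  "pair_vec k l i = delta k i - delta l i"

locale chord_cycle =
  fixes n b \<rho> :: nat
  assumes n3: "3 \<le> n" and b0: "0 < b" and bn: "b < n" and \<rho>0: "0 < \<rho>"
begin

definition mark :: "int \<Rightarrow> bool" where
  "mark v \<longleftrightarrow> int n dvd v \<or> int n dvd v - int b"

text \<open>This is \<open>Q - 2 I\<close>: the diagonal entry of the signless Laplacian is 2 on the cycle, and the chord adds
\<open>\<rho>\<close> to the two diagonal entries and to the two off-diagonal entries of its end points.\<close>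

definition kernel :: "nat \<Rightarrow> nat \<Rightarrow> real" where
  "kernel i j = cycle_graph n i j + (if i \<in> {0, b} \<and> j \<in> {0, b} then real \<rho> else 0)"

text \<open>Vectors on the \<open>n\<close> vertices become periodic functions on \<open>int\<close>, so that the neighbours of \<open>v\<close> are
\<open>v - 1\<close> and \<open>v + 1\<close> without exception.\<close>

definition per :: "(nat \<Rightarrow> real) \<Rightarrow> int \<Rightarrow> real" where
  "per f v = f (nat (v mod int n))"

lemma cycle_graph_commute: "cycle_graph n i j = cycle_graph n j i"
  using cong_minus_minus_iff[of "int i - int j" 1 "int n"] cong_minus_minus_iff[of "int i - int j" "-1" "int n"]
  by (auto simp: cycle_graph_def)

sublocale symmetric_kernel n kernel
  by unfold_locales (auto simp: kernel_def cycle_graph_commute)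

lemma per_of_nat: "i < n \<Longrightarrow> per f (int i) = f i"
  by (simp add: per_def)

lemma per_cong: "int n dvd u - v \<Longrightarrow> per f u = per f v"
  by (simp add: per_def mod_eq_dvd_iff[THEN iffD2])

lemma cycle_graph_iff:
  assumes "j < n"
  shows "cycle_graph n (nat (v mod int n)) j =
    (if j = nat ((v - 1) mod int n) \<or> j = nat ((v + 1) mod int n) then 1 else 0)"
proof -
  have pos: "0 < int n" using n3 by simp
  have "[int (nat (v mod int n)) - int j = c] (mod int n) \<longleftrightarrow> j = nat ((v - c) mod int n)" for c
  proof -
    have "[int (nat (v mod int n)) - int j = c] (mod int n) \<longleftrightarrow> int n dvd v mod int n - int j - c"
      using pos by (simp add: cong_iff_dvd_diff)
    also have "\<dots> \<longleftrightarrow> int n dvd (v - c) - int j"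
      by (simp add: dvd_eq_mod_eq_0 mod_simps algebra_simps)
    also have "\<dots> \<longleftrightarrow> (v - c) mod int n = int j mod int n"
      by (simp add: mod_eq_dvd_iff)
    also have "\<dots> \<longleftrightarrow> j = nat ((v - c) mod int n)"
      using assms pos by auto
    finally show ?thesis .
  qed
  from this[of 1] this[of "-1"] show ?thesis by (simp add: cycle_graph_def)
qed

lemma mark_iff: "mark v \<longleftrightarrow> nat (v mod int n) \<in> {0, b}"
proof -
  have pos: "0 < int n" using n3 by simp
  have "nat (v mod int n) = b \<longleftrightarrow> v mod int n = int b mod int n"
    using bn pos by (auto simp: nat_eq_iff)
  moreover have "nat (v mod int n) = 0 \<longleftrightarrow> int n dvd v"
    using pos_mod_sign[OF pos, of v] by (auto simp: dvd_eq_mod_eq_0)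
  ultimately show ?thesis by (simp add: mark_def mod_eq_dvd_iff)
qed

lemma per_L:
  "per (L f) v = per f (v + 1) + per f (v - 1) +
     (if mark v then real \<rho> * (per f 0 + per f (int b)) else 0)"
proof -
  define i where "i = nat (v mod int n)"
  define p q where "p = nat ((v - 1) mod int n)" and "q = nat ((v + 1) mod int n)"
  have pos: "0 < int n" using n3 by simp
  have lt: "i < n" "p < n" "q < n" using pos by (simp_all add: i_def p_def q_def nat_less_iff)
  have "p \<noteq> q"
  proof
    assume "p = q"
    moreover have "int p = (v - 1) mod int n" "int q = (v + 1) mod int n"
      using pos by (simp_all add: p_def q_def)
    ultimately have "(v - 1) mod int n = (v + 1) mod int n" by simp
    then have "int n dvd (v + 1) - (v - 1)" by (metis mod_eq_dvd_iff)
    then have "int n dvd 2" by simp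
    then show False using n3 zdvd_imp_le by fastforce
  qed
  have "per (L f) v = (\<Sum>j<n. kernel i j * f j)"
    using lt by (simp add: per_def L_def i_def)
  also have "\<dots> = (\<Sum>j<n. (if j = p \<or> j = q then 1 else 0) * f j) +
      (\<Sum>j<n. (if i \<in> {0, b} \<and> j \<in> {0, b} then real \<rho> else 0) * f j)"
    unfolding sum.distrib[symmetric] kernel_def i_def p_def q_def
    by (intro sum.cong refl) (simp add: cycle_graph_iff algebra_simps)
  also have "(\<Sum>j<n. (if j = p \<or> j = q then 1 else 0) * f j) = (\<Sum>j\<in>{p, q}. f j)"
    using lt by (intro sum.mono_neutral_cong_right) auto
  also have "\<dots> = f q + f p" using \<open>p \<noteq> q\<close> by simp
  also have "(\<Sum>j<n. (if i \<in> {0, b} \<and> j \<in> {0, b} then real \<rho> else 0) * f j) =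
      (if i \<in> {0, b} then \<Sum>j\<in>{0, b}. real \<rho> * f j else 0)"
    using bn by (auto intro!: sum.mono_neutral_cong_right split: if_splits)
  also have "\<dots> = (if mark v then real \<rho> * (per f 0 + per f (int b)) else 0)"
    using b0 bn unfolding mark_iff i_def by (simp add: per_def distrib_left)
  finally show ?thesis by (simp add: per_def p_def q_def)
qed

end

section \<open>Zeros and signs of eigenvectors\<close>

context chord_cycle
begin

definition eigen :: "real \<Rightarrow> (int \<Rightarrow> real) \<Rightarrow> bool" where
  "eigen t F \<longleftrightarrow> (\<forall>u v. int n dvd u - v \<longrightarrow> F u = F v) \<and>
     (\<forall>v. t * F v = F (v + 1) + F (v - 1) + (if mark v then real \<rho> * (F 0 + F (int b)) else 0))"

lemma eigen_per:
  assumes "L z = (\<lambda>i. t * z i)"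
  shows "eigen t (per z)"
proof -
  have "t * per z v = per (L z) v" for v by (simp add: assms per_def)
  then show ?thesis unfolding eigen_def per_L using per_cong by blast
qed

lemma eigen_uminus: "eigen t F \<Longrightarrow> eigen t (\<lambda>v. - F v)"
  by (force simp: eigen_def algebra_simps)

lemma periodic_induct:
  assumes "P v0" and "\<And>v. P v \<Longrightarrow> P (v + 1)" and per: "\<And>u v. int n dvd u - v \<Longrightarrow> P u = P v"
  shows "P v"
proof -
  have "P (v0 + int j)" for j
  proof (induction j)
    case (Suc j)
    then show ?case using assms(2)[of "v0 + int j"] by (simp add: algebra_simps)
  qed (simp add: assms(1))
  then have "P (v0 + int (nat ((v - v0) mod int n)))" .
  moreover have "int (nat ((v - v0) mod int n)) = (v - v0) mod int n" using n3 by simp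
  moreover have "int n dvd v - (v0 + (v - v0) mod int n)"
    using dvd_minus_mod[of "int n" "v - v0"] by (simp add: algebra_simps)
  ultimately show ?thesis using per by metis
qed

lemma periodic_arg_min:
  fixes F :: "int \<Rightarrow> real"
  assumes per: "\<And>u v. int n dvd u - v \<Longrightarrow> F u = F v"
  obtains v0 where "\<And>v. F v0 \<le> F v"
proof -
  have "finite (F ` {0..<int n})" "F ` {0..<int n} \<noteq> {}" using n3 by auto
  then obtain v0 where v0: "\<And>v. v \<in> {0..<int n} \<Longrightarrow> F v0 \<le> F v"
    using Min_in[of "F ` {0..<int n}"] Min_le[of "F ` {0..<int n}"] by (metis (no_types, lifting) imageE imageI)
  have "F v0 \<le> F v" for v
  proof -
    have "F v = F (v mod int n)" by (rule per) (simp add: dvd_eq_mod_eq_0 mod_simps)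
    then show ?thesis using v0[of "v mod int n"] n3 by simp
  qed
  then show ?thesis by (rule that)
qed

text \<open>Away from the marks the eigenvalue equation is a second order recurrence, so two consecutive zeros
spread in both directions up to the nearest mark on either side. These are the two different marks,
so \<open>F\<close> vanishes at both and the chord term disappears from the equation everywhere; then the zeros
spread over the whole cycle.\<close>

lemma eigen_two_zeros:
  assumes F: "eigen t F" and "F v = 0" "F (v + 1) = 0"
  shows "F u = 0"
proof -
  have per: "F u = F v" if "int n dvd u - v" for u v using F that by (simp add: eigen_def)
  have rec: "t * F v = F (v + 1) + F (v - 1) + (if mark v then real \<rho> * (F 0 + F (int b)) else 0)" for v
    using F by (simp add: eigen_def)
  have run: "h j = 0 \<and> h (Suc j) = 0" if "h 0 = 0" "h (Suc 0) = 0" "Suc j \<le> m"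
    "\<And>j. Suc j < m \<Longrightarrow> t * h (Suc j) = h (Suc (Suc j)) + h j"
  for h :: "nat \<Rightarrow> real" and m j using that(3)
  proof (induction j)
    case (Suc j)
    then show ?case using that(4)[of j] by simp
  qed (simp add: that)
  define w where "w = v mod int n"
  have w: "0 \<le> w" "w < int n" using n3 by (simp_all add: w_def)
  have "int n dvd w - v" "int n dvd (w + 1) - (v + 1)"
    by (simp_all add: w_def dvd_eq_mod_eq_0 mod_simps)
  then have z: "F w = 0" "F (w + 1) = 0" using per assms(2,3) by metis+
  have zero: "F hi = 0 \<and> F lo = 0" if "lo \<le> w" "w + 1 \<le> hi" "\<And>u. lo < u \<Longrightarrow> u < hi \<Longrightarrow> \<not> mark u" for lo hi
  proof
    have "F (w + int (Suc (nat (hi - w - 1)))) = 0"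
      using run[of "\<lambda>j. F (w + int j)" "nat (hi - w - 1)" "nat (hi - w)"] z that rec[of "w + 1 + int j" for j]
      by (simp add: algebra_simps)
    then show "F hi = 0" using that(2) by simp
    have "F (w + 1 - int (Suc (nat (w - lo)))) = 0"
      using run[of "\<lambda>j. F (w + 1 - int j)" "nat (w - lo)" "nat (w + 1 - lo)"] z that rec[of "w - int j" for j]
      by (simp add: algebra_simps)
    then show "F lo = 0" using that(1) by simp
  qed
  have nomark: "\<not> mark u" if "0 < u" "u < int n" "u \<noteq> int b" for u
    using that bn by (auto simp: mark_iff nat_eq_iff)
  have "F 0 + F (int b) = 0"
  proof (cases "w < int b")
    case True
    then show ?thesis using zero[of 0 "int b"] w nomark bn by auto
  next
    case False
    then have "F (int n) = 0 \<and> F (int b) = 0" using zero[of "int b" "int n"] w nomark by auto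
    moreover have "F (int n) = F 0" by (rule per) simp
    ultimately show ?thesis by simp
  qed
  then have rec0: "t * F v = F (v + 1) + F (v - 1)" for v using rec[of v] by simp
  have "F u = 0 \<and> F (u + 1) = 0"
  proof (rule periodic_induct[of "\<lambda>u. F u = 0 \<and> F (u + 1) = 0" w])
    show "F (v + 1) = 0 \<and> F (v + 1 + 1) = 0" if "F v = 0 \<and> F (v + 1) = 0" for v
      using that rec0[of "v + 1"] by simp
    show "(F u = 0 \<and> F (u + 1) = 0) = (F v = 0 \<and> F (v + 1) = 0)" if "int n dvd u - v" for u v
      using per[of u v] per[of "u + 1" "v + 1"] that by simp
  qed (use z in simp)
  then show ?thesis ..
qed

text \<open>Minimum principle: where a minimum of \<open>F\<close> is \<open>\<le> 0\<close>, we have \<open>t * F v \<le> 2 * F v\<close>, so both neighbours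
are minima as well.\<close>

lemma superharmonic:
  assumes per: "\<And>u v. int n dvd u - v \<Longrightarrow> F u = F v" and "2 \<le> t"
    and sup: "\<And>v. F (v + 1) + F (v - 1) \<le> t * F v"
  shows "(\<forall>v. 0 < F v) \<or> (\<exists>c\<le>(0 :: real). \<forall>v. F v = c)"
proof -
  obtain v0 where v0: "\<And>v. F v0 \<le> F v" using periodic_arg_min[of F] per by blast
  show ?thesis
  proof (cases "0 < F v0")
    case True
    then show ?thesis using v0 by (meson less_le_trans)
  next
    case False
    have "F v = F v0" for v
    proof (rule periodic_induct[of "\<lambda>v. F v = F v0" v0])
      show "F (v + 1) = F v0" if "F v = F v0" for v
      proof -
        have "0 \<le> (t - 2) * - F v0" using False \<open>2 \<le> t\<close> by (intro mult_nonneg_nonneg) auto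
        then have "t * F v0 \<le> 2 * F v0" by (simp add: algebra_simps)
        then show ?thesis using sup[of v] v0[of "v + 1"] v0[of "v - 1"] that by simp
      qed
      show "(F u = F v0) = (F v = F v0)" if "int n dvd u - v" for u v using per[OF that] by simp
    qed simp
    then show ?thesis using False by (intro disjI2 exI[of _ "F v0"]) auto
  qed
qed

text \<open>After a change of sign the chord term is \<open>\<ge> 0\<close>, so that \<open>F\<close> is superharmonic.\<close>

lemma eigen_ge_2_positive:
  assumes F: "eigen t F" and t: "2 \<le> t" and nz: "F u \<noteq> 0"
  shows "(\<forall>v. 0 < F v) \<or> (\<forall>v. F v < 0)"
proof -
  have main: "\<forall>v. 0 < G v" if G: "eigen t G" and nz: "G u \<noteq> 0" and s: "0 \<le> G 0 + G (int b)" for G u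
  proof -
    have per: "\<And>u v. int n dvd u - v \<Longrightarrow> G u = G v" using G by (simp add: eigen_def)
    have "G (v + 1) + G (v - 1) \<le> t * G v" for v
    proof -
      have "t * G v = G (v + 1) + G (v - 1) + (if mark v then real \<rho> * (G 0 + G (int b)) else 0)"
        using G by (simp add: eigen_def)
      moreover have "0 \<le> real \<rho> * (G 0 + G (int b))" using s by simp
      ultimately show ?thesis by (simp split: if_splits)
    qed
    from superharmonic[OF per t this] show ?thesis using s nz by force
  qed
  show ?thesis
  proof (cases "0 \<le> F 0 + F (int b)")
    case True
    then show ?thesis using main[OF F nz] by blast
  next
    case False
    have "\<forall>v. 0 < - F v" by (rule main[OF eigen_uminus[OF F], of u]) (use False nz in auto)
    then show ?thesis by simp
  qed
qed

text \<open>At a vertex where \<open>\<bar>F\<bar>\<close> attains its maximum \<open>M\<close>, say with the value \<open>M\<close>, the right-hand side of the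
eigenvalue equation is at least \<open>-2 M\<close>, because the chord term at a mark is \<open>\<ge> 0\<close> there. So equality holds,
both neighbours have the value \<open>-M\<close> and the chord term is 0. Hence \<open>F\<close> alternates around the
whole cycle and changes sign along the chord.\<close>

lemma eigen_le_minus2_alternating:
  assumes F: "eigen t F" and t: "t \<le> -2" and nz: "F u \<noteq> 0"
  shows "t = -2" and "F v \<noteq> 0" and "even n" and "odd b"
proof -
  have per: "F u = F v" if "int n dvd u - v" for u v using F that by (simp add: eigen_def)
  have rec: "t * F v = F (v + 1) + F (v - 1) + (if mark v then real \<rho> * (F 0 + F (int b)) else 0)" for v
    using F by (simp add: eigen_def)
  obtain v0 where "\<And>v. - \<bar>F v0\<bar> \<le> - \<bar>F v\<bar>"
    using periodic_arg_min[of "\<lambda>v. - \<bar>F v\<bar>"] per by metis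
  then have v0: "\<bar>F v\<bar> \<le> \<bar>F v0\<bar>" for v by simp
  define M where "M = \<bar>F v0\<bar>"
  have M: "0 < M" using v0[of u] nz by (simp add: M_def)
  have max: "t = -2 \<and> F (v + 1) = - F v \<and> (mark v \<longrightarrow> F 0 + F (int b) = 0)" if v: "\<bar>F v\<bar> = M" for v
  proof -
    define s where "s = sgn (F v)"
    have s: "s = 1 \<or> s = -1" "s * F v = M" using v M by (auto simp: s_def sgn_if abs_if split: if_splits)
    have sF: "- M \<le> s * F u" for u using s(1) v0[of u] by (auto simp: M_def)
    have "mark v \<Longrightarrow> F v = F 0 \<or> F v = F (int b)" using per[of v 0] per[of v "int b"] by (auto simp: mark_def)
    then have chord: "mark v \<Longrightarrow> 0 \<le> s * (F 0 + F (int b))"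
      using s(2) sF[of 0] sF[of "int b"] by (auto simp: distrib_left)
    have "s * (t * F v) = s * (F (v + 1) + F (v - 1) + (if mark v then real \<rho> * (F 0 + F (int b)) else 0))"
      unfolding rec[of v] ..
    then have e: "t * M = s * F (v + 1) + s * F (v - 1) + (if mark v then real \<rho> * (s * (F 0 + F (int b))) else 0)"
      unfolding s(2)[symmetric] by (simp add: algebra_simps)
    have c0: "0 \<le> (if mark v then real \<rho> * (s * (F 0 + F (int b))) else 0)"
      using chord by simp
    have tM: "t * M \<le> - 2 * M" using t M by (intro mult_right_mono) auto
    have "t * M = - 2 * M" and p: "s * F (v + 1) = - M"
      and c: "(if mark v then real \<rho> * (s * (F 0 + F (int b))) else 0) = 0"
      using e c0 tM sF[of "v + 1"] sF[of "v - 1"] by linarith+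
    then have "(t + 2) * M = 0" by (simp add: algebra_simps)
    then have "t = -2" using M by simp
    moreover have "s * F (v + 1) = s * - F v" using p s(2) by simp
    then have "F (v + 1) = - F v" using s(1) by auto
    moreover have "F 0 + F (int b) = 0" if "mark v" using c that \<rho>0 s(1) by auto
    ultimately show ?thesis by blast
  qed
  have all: "\<bar>F v\<bar> = M" for v
  proof (rule periodic_induct[of "\<lambda>v. \<bar>F v\<bar> = M" v0])
    show "\<bar>F (v + 1)\<bar> = M" if "\<bar>F v\<bar> = M" for v using max[OF that] that by simp
    show "(\<bar>F u\<bar> = M) = (\<bar>F v\<bar> = M)" if "int n dvd u - v" for u v using per[OF that] by simp
  qed (simp add: M_def)
  show "t = -2" using max[OF all] by blast
  show nzv: "F v \<noteq> 0" for v using all[of v] M by auto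
  have alt: "F (int j) = (-1) ^ j * F 0" for j
  proof (induction j)
    case (Suc j)
    then show ?case using max[OF all, of "int j"] by (simp add: add.commute)
  qed simp
  have "F (int n) = F 0" by (rule per) simp
  then show "even n" using alt[of n] nzv[of 0] by (cases "even n") auto
  have "mark 0" by (simp add: mark_def)
  then have "F 0 + F (int b) = 0" using max[OF all[of 0]] by blast
  then show "odd b" using alt[of b] nzv[of 0] by (cases "even b") auto
qed

end

section \<open>Balls covering the cycle\<close>

context chord_cycle
begin

text \<open>The arc of radius \<open>r\<close> around \<open>u\<close> in the cycle without the chord; it is empty for negative \<open>r\<close>.\<close>

definition near :: "int \<Rightarrow> int \<Rightarrow> int \<Rightarrow> bool" where
  "near u r v \<longleftrightarrow> (\<exists>t. \<bar>t\<bar> \<le> r \<and> int n dvd v - (u + t))"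

lemma near_refl: "0 \<le> r \<Longrightarrow> near u r u"
  unfolding near_def by (intro exI[of _ 0]) simp

lemma near_mono: "near u r v \<Longrightarrow> r \<le> s \<Longrightarrow> near u s v"
  unfolding near_def by (meson order_trans)

lemma near_nonneg: "near u r v \<Longrightarrow> 0 \<le> r"
  unfolding near_def by fastforce

lemma near_trans:
  assumes "near u r v" "near v s w"
  shows "near u (r + s) w"
proof -
  obtain t t' where t: "\<bar>t\<bar> \<le> r" "int n dvd v - (u + t)" "\<bar>t'\<bar> \<le> s" "int n dvd w - (v + t')"
    using assms unfolding near_def by blast
  have "int n dvd (w - (v + t')) + (v - (u + t))" using t by (intro dvd_add)
  then have "int n dvd w - (u + (t + t'))" by (simp add: algebra_simps)
  then show ?thesis unfolding near_def using t by (intro exI[of _ "t + t'"]) auto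
qed

lemma near_sym:
  assumes "near u r v"
  shows "near v r u"
proof -
  obtain t where t: "\<bar>t\<bar> \<le> r" "int n dvd v - (u + t)" using assms unfolding near_def by blast
  have "int n dvd - (v - (u + t))" using t(2) by (simp only: dvd_minus_iff)
  then have "int n dvd u - (v + - t)" by (simp add: algebra_simps)
  then show ?thesis unfolding near_def using t by (intro exI[of _ "- t"]) auto
qed

lemma near_0_iff: "near u 0 v \<longleftrightarrow> int n dvd v - u"
  by (auto simp: near_def)

lemma near_shift: "near u 1 (u + 1)" "near u 1 (u - 1)"
proof -
  show "near u 1 (u + 1)" unfolding near_def by (intro exI[of _ 1]) simp
  show "near u 1 (u - 1)" unfolding near_def by (intro exI[of _ "-1"]) simp
qed

text \<open>The ball of radius \<open>j\<close> in the graph. The chord clause also lets a mark reach itself, in accordance with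
the diagonal entries of the kernel.\<close>

fun reach :: "int \<Rightarrow> nat \<Rightarrow> int \<Rightarrow> bool" where
  "reach u 0 v \<longleftrightarrow> int n dvd v - u"
| "reach u (Suc j) v \<longleftrightarrow> reach u j v \<or> reach u j (v + 1) \<or> reach u j (v - 1) \<or>
     (mark v \<and> (\<exists>w. mark w \<and> reach u j w))"

lemma reach_mono: "reach u i v \<Longrightarrow> i \<le> j \<Longrightarrow> reach u j v"
  by (induction j) (auto simp: le_Suc_eq)

lemma mark_0 [simp]: "mark 0" and mark_b [simp]: "mark (int b)"
  by (simp_all add: mark_def)

lemma per_delta:
  assumes "k < n" and "per (delta k) v \<noteq> 0"
  shows "reach (int k) 0 v"
proof -
  have "nat (v mod int n) = k" using assms(2) by (simp add: per_def delta_def split: if_splits)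
  then have "v mod int n = int k mod int n" using assms(1) n3 by auto
  then show ?thesis by (simp add: mod_eq_dvd_iff)
qed

lemma reach_power:
  assumes "k < n"
  shows "per ((L ^^ j) (delta k)) v \<noteq> 0 \<Longrightarrow> reach (int k) j v"
proof (induction j arbitrary: v)
  case 0
  then show ?case using per_delta[OF assms, of v] by simp
next
  case (Suc j)
  let ?F = "per ((L ^^ j) (delta k))"
  have "?F (v + 1) + ?F (v - 1) + (if mark v then real \<rho> * (?F 0 + ?F (int b)) else 0) \<noteq> 0"
    using Suc.prems by (simp add: per_L)
  then have "?F (v + 1) \<noteq> 0 \<or> ?F (v - 1) \<noteq> 0 \<or> mark v \<and> (?F 0 \<noteq> 0 \<or> ?F (int b) \<noteq> 0)"
    by (auto split: if_splits)
  then show ?case using Suc.IH mark_0 mark_b by (auto simp del: mark_0 mark_b)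
qed

lemma per_poly_op:
  assumes "degree p \<le> N"
  shows "per (poly_op p f) v = (\<Sum>j\<le>N. coeff p j * per ((L ^^ j) f) v)"
  unfolding per_def by (rule poly_op_bound[OF assms])

lemma reach_poly_op:
  assumes "k < n" "degree p \<le> j" "per (poly_op p (delta k)) v \<noteq> 0"
  shows "reach (int k) j v"
proof -
  obtain i where "i \<le> j" "per ((L ^^ i) (delta k)) v \<noteq> 0"
    using assms(3) unfolding per_poly_op[OF assms(2)] by (auto elim: sum.not_neutral_contains_not_neutral)
  then show ?thesis using reach_power[OF assms(1)] reach_mono by blast
qed

definition other_mark :: "int \<Rightarrow> int" where
  "other_mark c = (if c = 0 then int b else 0)"

lemma mark_cases: "mark v \<Longrightarrow> c \<in> {0, int b} \<Longrightarrow> int n dvd v - c \<or> int n dvd v - other_mark c"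
  by (auto simp: mark_def other_mark_def)

text \<open>Let \<open>c = u + e\<close> be a mark nearest to \<open>u\<close>. Crossing the chord from \<open>c\<close> starts a second arc around the other
mark after \<open>\<bar>e\<bar> + 1\<close> steps. Crossing in the other direction gains nothing, as \<open>c\<close> is no farther from
\<open>u\<close> than the other mark.\<close>

lemma reach_near:
  obtains c e where "c \<in> {0, int b}" "near u \<bar>e\<bar> c" "int n dvd c - (u + e)"
    "\<And>j v. reach u j v \<Longrightarrow> near u (int j) v \<or> near (other_mark c) (int j - 1 - \<bar>e\<bar>) v"
proof -
  define P where "P r \<longleftrightarrow> (\<exists>e. \<bar>e\<bar> = int r \<and> (\<exists>c\<in>{0, int b}. int n dvd c - (u + e)))" for r
  have "P (nat \<bar>- u\<bar>)" unfolding P_def by (intro exI[of _ "- u"] conjI bexI[of _ 0]) simp_all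
  then have "P (LEAST r. P r)" by (rule LeastI)
  then obtain e c where e: "\<bar>e\<bar> = int (LEAST r. P r)" and c: "c \<in> {0, int b}" "int n dvd c - (u + e)"
    unfolding P_def by blast
  have least: "\<bar>e\<bar> \<le> r" if r: "near u r w" and "mark w" for r w
  proof -
    obtain t where t: "\<bar>t\<bar> \<le> r" "int n dvd w - (u + t)" using r unfolding near_def by blast
    have "\<exists>d\<in>{0, int b}. int n dvd w - d" using \<open>mark w\<close> by (auto simp: mark_def)
    then obtain d where d: "d \<in> {0, int b}" "int n dvd w - d" by blast
    have "int n dvd (w - (u + t)) - (w - d)" by (rule dvd_diff[OF t(2) d(2)])
    then have "int n dvd d - (u + t)" by (simp add: algebra_simps)
    then have "P (nat \<bar>t\<bar>)" unfolding P_def using d(1) by auto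
    then have "(LEAST r. P r) \<le> nat \<bar>t\<bar>" by (rule Least_le)
    then show ?thesis using e t(1) by simp
  qed
  have uc: "near u \<bar>e\<bar> c" unfolding near_def using c(2) by (intro exI[of _ e]) simp
  have main: "near u (int j) v \<or> near (other_mark c) (int j - 1 - \<bar>e\<bar>) v" if "reach u j v" for j v
    using that
  proof (induction j arbitrary: v)
    case 0
    then show ?case by (simp add: near_0_iff)
  next
    case (Suc j)
    have step: "near u (int (Suc j)) v \<or> near (other_mark c) (int (Suc j) - 1 - \<bar>e\<bar>) v"
      if "near u (int j) w \<or> near (other_mark c) (int j - 1 - \<bar>e\<bar>) w" "near w 1 v" for w
      using that near_trans[OF _ that(2), of u "int j"] near_trans[OF _ that(2), of "other_mark c" "int j - 1 - \<bar>e\<bar>"]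
      by (auto simp: algebra_simps)
    have wv: "near (v + 1) 1 v" "near (v - 1) 1 v" "near v 1 v"
      using near_shift(2)[of "v + 1"] near_shift(1)[of "v - 1"] near_refl[of 1 v] by simp_all
    from Suc.prems consider "reach u j v" | "reach u j (v + 1)" | "reach u j (v - 1)"
      | w where "mark v" "mark w" "reach u j w" by auto
    then show ?case
    proof cases
      case 1
      then show ?thesis using step[OF Suc.IH wv(3)] by blast
    next
      case 2
      then show ?thesis using step[OF Suc.IH wv(1)] by blast
    next
      case 3
      then show ?thesis using step[OF Suc.IH wv(2)] by blast
    next
      case 4
      have ej: "\<bar>e\<bar> \<le> int j"
        using Suc.IH[OF 4(3)]
      proof
        assume "near u (int j) w"
        then show ?thesis by (rule least[OF _ 4(2)])
      next
        assume "near (other_mark c) (int j - 1 - \<bar>e\<bar>) w"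
        then show ?thesis using near_nonneg by fastforce
      qed
      from mark_cases[OF 4(1) c(1)] show ?thesis
      proof
        assume "int n dvd v - c"
        then have "near c 0 v" by (simp add: near_0_iff)
        from near_trans[OF uc this] show ?thesis using ej near_mono[of u "\<bar>e\<bar>" v "int (Suc j)"] by simp
      next
        assume "int n dvd v - other_mark c"
        then have "near (other_mark c) 0 v" by (simp add: near_0_iff)
        then show ?thesis using ej near_mono[of "other_mark c" 0 v] by simp
      qed
    qed
  qed
  show ?thesis by (rule that[OF c(1) uc c(2) main])
qed

text \<open>Each ball contributes an arc beyond the chord, but one of these arcs is superfluous. Let the centre with
the larger remaining radius at its nearest mark be the one that keeps its arc. The other arc either is
around the same mark and smaller, or it is around the mark from which the first ball crosses; in that case
it lies in the arc of that ball around its own centre (\<open>absorb\<close>).\<close>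

lemma two_balls_cover:
  fixes k l :: int and p q :: nat
  assumes "\<And>v. reach k p v \<or> reach l q v"
  obtains u r c e where "(u, r) \<in> {(k, p), (l, q)}" "c \<in> {0, int b}" "int n dvd c - (u + e)"
    "\<And>v. near k (int p) v \<or> near l (int q) v \<or> near (other_mark c) (int r - 1 - \<bar>e\<bar>) v"
proof -
  obtain c e where c: "c \<in> {0, int b}" "near k \<bar>e\<bar> c" "int n dvd c - (k + e)"
    "\<And>j v. reach k j v \<Longrightarrow> near k (int j) v \<or> near (other_mark c) (int j - 1 - \<bar>e\<bar>) v"
    by (rule reach_near[of k]) blast
  obtain c' e' where c': "c' \<in> {0, int b}" "near l \<bar>e'\<bar> c'" "int n dvd c' - (l + e')"
    "\<And>j v. reach l j v \<Longrightarrow> near l (int j) v \<or> near (other_mark c') (int j - 1 - \<bar>e'\<bar>) v"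
    by (rule reach_near[of l]) blast
  have absorb: "near m (int s) v \<or> near (other_mark d) (int s - 1 - \<bar>f\<bar>) v"
    if "near (other_mark d') (int s' - 1 - \<bar>f'\<bar>) v" "int s' - \<bar>f'\<bar> \<le> int s - \<bar>f\<bar>"
      "near m \<bar>f\<bar> d" "d \<in> {0, int b}" "d' \<in> {0, int b}" for m s v d f d' s' f'
  proof (cases "d = d'")
    case True
    then show ?thesis using that(1,2) near_mono[of "other_mark d"] by simp
  next
    case False
    then have "other_mark d' = d" using that(4,5) b0 by (auto simp: other_mark_def)
    then have "near m (\<bar>f\<bar> + (int s' - 1 - \<bar>f'\<bar>)) v" using near_trans[OF that(3)] that(1) by simp
    then show ?thesis using near_mono[of m _ v "int s"] that(2) by simp
  qed
  show ?thesis
  proof (cases "int q - \<bar>e'\<bar> \<le> int p - \<bar>e\<bar>")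
    case True
    show ?thesis
    proof (rule that[of k p c e])
      fix v
      show "near k (int p) v \<or> near l (int q) v \<or> near (other_mark c) (int p - 1 - \<bar>e\<bar>) v"
        using assms[of v] c(4)[of p v] c'(4)[of q v] absorb[of c' q e' v p e k c] True c(1,2) c'(1) by blast
    qed (use c in auto)
  next
    case False
    show ?thesis
    proof (rule that[of l q c' e'])
      fix v
      show "near k (int p) v \<or> near l (int q) v \<or> near (other_mark c') (int q - 1 - \<bar>e'\<bar>) v"
        using assms[of v] c(4)[of p v] c'(4)[of q v] absorb[of c p e v q e' l c'] False c'(1,2) c(1) by auto
    qed (use c' in auto)
  qed
qed

lemma three_intervals_card:
  assumes "\<And>v. near u1 r1 v \<or> near u2 r2 v \<or> near u3 r3 v"
    and r: "r1 \<le> int s1" "r2 \<le> int s2" "r3 \<le> int s3"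
  shows "n \<le> (2 * s1 + 1) + (2 * s2 + 1) + (2 * s3 + 1)"
proof -
  define I where "I u s = (\<lambda>t. (u + t) mod int n) ` {- int s..int s}" for u s
  have nI: "v \<in> I u s" if uv: "near u r v" "r \<le> int s" "v \<in> {0..<int n}" for u r s v
  proof -
    obtain t where t: "\<bar>t\<bar> \<le> r" "int n dvd v - (u + t)" using uv(1) unfolding near_def by blast
    then have "v mod int n = (u + t) mod int n" by (simp add: mod_eq_dvd_iff)
    then have "v = (u + t) mod int n" using uv(3) by simp
    moreover have "t \<in> {- int s..int s}" using t(1) uv(2) by auto
    ultimately show ?thesis unfolding I_def by (rule image_eqI)
  qed
  have cI: "card (I u s) \<le> 2 * s + 1" "finite (I u s)" for u s
    using card_image_le[of "{- int s..int s}" "\<lambda>t. (u + t) mod int n"] by (auto simp: I_def)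
  have "{0..<int n} \<subseteq> I u1 s1 \<union> I u2 s2 \<union> I u3 s3"
    using assms nI by blast
  then have "card {0..<int n} \<le> card (I u1 s1 \<union> I u2 s2 \<union> I u3 s3)"
    using cI by (intro card_mono) auto
  also have "\<dots> \<le> card (I u1 s1) + card (I u2 s2) + card (I u3 s3)"
    using card_Un_le[of "I u1 s1 \<union> I u2 s2" "I u3 s3"] card_Un_le[of "I u1 s1" "I u2 s2"] by linarith
  also have "\<dots> \<le> (2 * s1 + 1) + (2 * s2 + 1) + (2 * s3 + 1)"
    using cI(1) by (intro add_mono)
  finally show ?thesis by simp
qed

text \<open>If the chord is a diameter, the arc beyond it can be placed relative to the centre \<open>u\<close> of the ball,
whatever the distance \<open>\<bar>e\<bar>\<close> from \<open>u\<close> to the mark is.\<close>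

lemma diameter_chord:
  assumes "n = 2 * b" "c \<in> {0, int b}" "int n dvd c - (u + e)" "near (other_mark c) (s - \<bar>e\<bar>) v"
  shows "near (u + int b) s v"
proof -
  have "int n dvd other_mark c - (c + int b)"
    using assms(1,2) b0 by (auto simp: other_mark_def)
  then have "int n dvd (other_mark c - (c + int b)) + (c - (u + e))"
    using assms(3) by (rule dvd_add)
  then have "int n dvd other_mark c - (u + int b + e)"
    by (simp add: algebra_simps)
  then have "near (u + int b) \<bar>e\<bar> (other_mark c)"
    unfolding near_def by (intro exI[of _ e]) simp
  from near_trans[OF this assms(4)] show ?thesis by simp
qed

lemma not_dvd_between: "0 < x \<Longrightarrow> x < int n \<Longrightarrow> \<not> int n dvd x"
  using zdvd_not_zless by blast

lemma near_between:
  assumes "near u r v" "r < v - u"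
  shows "int n \<le> v - u + r"
proof -
  obtain t where t: "\<bar>t\<bar> \<le> r" "int n dvd v - (u + t)" using assms(1) unfolding near_def by blast
  then show ?thesis using not_dvd_between[of "v - (u + t)"] assms(2) by linarith
qed

text \<open>In the diameter case the arcs around \<open>u\<close> and around its antipode both miss \<open>u + 4\<close> and \<open>u - 4\<close>, and these
are too far apart for the arc around the other centre to contain both.\<close>

lemma no_cover_3_3:
  assumes large: "22 \<le> n \<or> n = 2 * b \<and> 16 \<le> n"
    and cover: "\<And>v. reach k 3 v \<or> reach l 3 v"
  shows False
proof -
  obtain u r c e where u: "(u, r) \<in> {(k, 3), (l, 3)}" "c \<in> {0, int b}" "int n dvd c - (u + e)"
    and near: "\<And>v. near k (int 3) v \<or> near l (int 3) v \<or> near (other_mark c) (int r - 1 - \<bar>e\<bar>) v"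
    using two_balls_cover[of k 3 l 3] cover by metis
  have r: "r = 3" using u(1) by auto
  show False
  proof (cases "22 \<le> n")
    case True
    have "n \<le> (2 * 3 + 1) + (2 * 3 + 1) + (2 * 2 + 1)"
      by (rule three_intervals_card[OF near]) (simp_all add: r)
    then show False using True by simp
  next
    case False
    then have n: "n = 2 * b" "16 \<le> n" using large by auto
    obtain w where w: "\<And>v. near u 3 v \<or> near w 3 v \<or> near (u + int b) 2 v"
    proof -
      have "near k 3 v \<or> near l 3 v \<or> near (u + int b) 2 v" for v
        using near[of v] diameter_chord[OF n(1) u(2,3), of 2 v] by (auto simp: r)
      then show ?thesis using u(1) that[of k] that[of l] by auto
    qed
    have "near w 3 (u + 4)" using w[of "u + 4"] near_between[of u 3 "u + 4"]
        near_sym[of "u + int b" 2 "u + 4"] near_between[of "u + 4" 2 "u + int b"] n by auto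
    moreover have "near w 3 (u - 4)" using w[of "u - 4"] near_sym[of u 3 "u - 4"] near_between[of "u - 4" 3 u]
        near_sym[of "u + int b" 2 "u - 4"] near_between[of "u - 4" 2 "u + int b"] n by auto
    ultimately have "near (u - 4) (3 + 3) (u + 4)" using near_trans near_sym by blast
    then show False using near_between[of "u - 4" 6 "u + 4"] n by simp
  qed
qed

text \<open>In the diameter case with the arc beyond the chord belonging to \<open>k\<close>, the vertices \<open>k + 5\<close> and \<open>k - 5\<close> are
missed by the arcs of \<open>k\<close> and too far apart for the arc of \<open>l\<close>. If it belongs to \<open>l\<close>, the three
arcs have \<open>9 + 5 + 3 = 17\<close> vertices.\<close>

lemma no_cover_4_2:
  assumes large: "22 \<le> n \<or> n = 2 * b \<and> 18 \<le> n"
    and cover: "\<And>v. reach k 4 v \<or> reach l 2 v"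
  shows False
proof -
  obtain u r c e where u: "(u, r) \<in> {(k, 4), (l, 2)}" "c \<in> {0, int b}" "int n dvd c - (u + e)"
    and near: "\<And>v. near k (int 4) v \<or> near l (int 2) v \<or> near (other_mark c) (int r - 1 - \<bar>e\<bar>) v"
    using two_balls_cover[of k 4 l 2] cover by metis
  show False
  proof (cases "22 \<le> n")
    case True
    have "n \<le> (2 * 4 + 1) + (2 * 2 + 1) + (2 * 3 + 1)"
      by (rule three_intervals_card[OF near]) (use u(1) in auto)
    then show False using True by simp
  next
    case False
    then have n: "n = 2 * b" "18 \<le> n" using large by auto
    have near': "near k 4 v \<or> near l 2 v \<or> near (u + int b) (int r - 1) v" for v
      using near[of v] diameter_chord[OF n(1) u(2,3), of "int r - 1" v] by auto
    show False
    proof (cases "r = 4")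
      case True
      then have w: "near k 4 v \<or> near l 2 v \<or> near (k + int b) 3 v" for v
        using near'[of v] u(1) by auto
      have "near l 2 (k + 5)" using w[of "k + 5"] near_between[of k 4 "k + 5"]
          near_sym[of "k + int b" 3 "k + 5"] near_between[of "k + 5" 3 "k + int b"] n by auto
      moreover have "near l 2 (k - 5)" using w[of "k - 5"] near_sym[of k 4 "k - 5"] near_between[of "k - 5" 4 k]
          near_sym[of "k + int b" 3 "k - 5"] near_between[of "k - 5" 3 "k + int b"] n by auto
      ultimately have "near (k - 5) (2 + 2) (k + 5)" using near_trans near_sym by blast
      then show False using near_between[of "k - 5" 4 "k + 5"] n by simp
    next
      case False
      then have r: "r = 2" using u(1) by auto
      have "n \<le> (2 * 4 + 1) + (2 * 2 + 1) + (2 * 1 + 1)"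
        by (rule three_intervals_card[OF near']) (simp_all add: r)
      then show False using n by simp
    qed
  qed
qed

end

section \<open>Support and covering contradict each other\<close>

text \<open>The four unit intervals that make up \<open>[-2, 2)\<close> contain at most one element of \<open>S\<close> each. Four elements
leave three gaps with a sum below 4, so one of them is below \<open>4 / 3\<close>.\<close>

lemma unit_gap_set:
  fixes S :: "real set"
  assumes gap: "\<forall>s\<in>S. \<forall>t\<in>S. s \<noteq> t \<longrightarrow> 1 \<le> \<bar>s - t\<bar>"
    and range: "\<forall>s\<in>S. -2 \<le> s \<and> s < 2"
  shows "card S \<le> 4"
    and "card S = 4 \<Longrightarrow> \<exists>s\<in>S. \<exists>t\<in>S. s \<noteq> t \<and> \<bar>s - t\<bar> < 4 / 3"
    and "card S = 4 \<Longrightarrow> S \<subseteq> \<int> \<Longrightarrow> S = {-2, -1, 0, 1}"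
proof -
  have inj: "inj_on floor S"
  proof (rule inj_onI, rule ccontr)
    fix s t assume st: "s \<in> S" "t \<in> S" "\<lfloor>s\<rfloor> = \<lfloor>t\<rfloor>" "s \<noteq> t"
    then have "\<bar>s - t\<bar> < 1" by linarith
    then show False using gap st by fastforce
  qed
  have img: "floor ` S \<subseteq> {-2..1}"
  proof
    fix m assume "m \<in> floor ` S"
    then obtain s where "s \<in> S" "m = \<lfloor>s\<rfloor>" by blast
    then show "m \<in> {-2..1}" using range by (simp add: le_floor_iff floor_le_iff)
  qed
  show "card S \<le> 4" using card_inj_on_le[OF inj img] by simp
  assume c4: "card S = 4"
  then have onto: "floor ` S = {-2..1}"
    using card_image[OF inj] img by (intro card_subset_eq) auto
  have ex: "\<exists>s\<in>S. \<lfloor>s\<rfloor> = m" if "m \<in> {-2..1}" for m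
  proof -
    have "m \<in> floor ` S" unfolding onto by (rule that)
    then show ?thesis by blast
  qed
  obtain s1 s2 s3 s4 where s: "s1 \<in> S" "\<lfloor>s1\<rfloor> = -2" "s2 \<in> S" "\<lfloor>s2\<rfloor> = -1" "s3 \<in> S" "\<lfloor>s3\<rfloor> = 0" "s4 \<in> S" "\<lfloor>s4\<rfloor> = 1"
    using ex[of "-2"] ex[of "-1"] ex[of 0] ex[of 1] by auto
  have "s1 < s2" "s2 < s3" "s3 < s4" using s by linarith+
  moreover have "s4 < 2" "-2 \<le> s1" using range s by blast+
  ultimately have "\<bar>s1 - s2\<bar> < 4 / 3 \<and> s1 \<noteq> s2 \<or> \<bar>s2 - s3\<bar> < 4 / 3 \<and> s2 \<noteq> s3 \<or> \<bar>s3 - s4\<bar> < 4 / 3 \<and> s3 \<noteq> s4"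
    by linarith
  then show "\<exists>s\<in>S. \<exists>t\<in>S. s \<noteq> t \<and> \<bar>s - t\<bar> < 4 / 3" using s by blast
  assume "S \<subseteq> \<int>"
  then have "s = of_int \<lfloor>s\<rfloor>" if "s \<in> S" for s using that by (metis Ints_cases floor_of_int subsetD)
  then have "S = of_int ` floor ` S" by force
  also have "\<dots> = of_int ` {-2, -1, 0, 1}" unfolding onto by (rule arg_cong[of _ _ "image _"]) auto
  finally show "S = {-2, -1, 0, 1}" by simp
qed

context chord_cycle
begin

lemma L_power_nonneg: "(\<And>i. 0 \<le> f i) \<Longrightarrow> 0 \<le> (L ^^ j) f i"
  by (induction j arbitrary: i) (auto simp: L_def kernel_def cycle_graph_def intro!: sum_nonneg)

text \<open>The polynomial is \<open>(X + 2) (X + 1) X (X - 1) = X\<^sup>4 + 2 X\<^sup>3 - X\<^sup>2 - 2 X\<close>. Beyond distance 2 from \<open>l\<close> only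
the terms with positive coefficients survive, and the kernel has nonnegative entries.\<close>

lemma sign_polynomial_nonneg:
  assumes "l < n" and "\<not> reach (int l) 2 v"
  shows "0 \<le> per (poly_op [:0, -2, -1, 2, 1:] (delta l)) v"
proof -
  have low: "per ((L ^^ j) (delta l)) v = 0" if "j \<le> 2" for j
    using reach_power[OF assms(1), of j v] reach_mono[of "int l" j v 2] assms(2) that by blast
  have z: "per ((L ^^ Suc 0) (delta l)) v = 0" "per ((L ^^ Suc (Suc 0)) (delta l)) v = 0"
    by (rule low, simp)+
  have nonneg: "0 \<le> per ((L ^^ j) (delta l)) v" for j
    unfolding per_def by (rule L_power_nonneg) (simp add: delta_def)
  have "per (poly_op [:0, -2, -1, 2, 1:] (delta l)) v =
      (\<Sum>j\<le>Suc (Suc (Suc (Suc 0))). coeff [:0, -2, -1, 2, 1:] j * per ((L ^^ j) (delta l)) v)"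
    by (rule per_poly_op) simp
  also have "\<dots> = 2 * per ((L ^^ 3) (delta l)) v + per ((L ^^ 4) (delta l)) v"
    using z by (simp add: numeral_3_eq_3 numeral_eq_Suc del: funpow.simps)
  also have "0 \<le> \<dots>" using nonneg by simp
  finally show ?thesis .
qed

lemma L_power_pair: "(L ^^ j) (pair_vec k l) = (\<lambda>i. (L ^^ j) (delta k) i - (L ^^ j) (delta l) i)"
proof (induction j)
  case (Suc j)
  then show ?case using L_lin[of 1 "(L ^^ j) (delta k)" "-1" "(L ^^ j) (delta l)"] by simp
qed (simp add: pair_vec_def fun_eq_iff)

lemma poly_op_pair: "per (poly_op p (pair_vec k l)) v = per (poly_op p (delta k)) v - per (poly_op p (delta l)) v"
  by (simp add: per_def poly_op_def L_power_pair sum_subtractf right_diff_distrib)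

lemma degree_omit_root:
  assumes "finite T" "t \<in> T"
  shows "degree (omit_root T t) = card T - 1"
  unfolding omit_root_def using coeffs_prod_linear(1)[of "T - {t}"] assms by simp

text \<open>Below, \<open>z t\<close> is the component of \<open>pair_vec k l\<close> for the eigenvalue \<open>t \<in> T\<close>. A vertex where it does not vanish
is within distance \<open>card T - 1\<close> of \<open>k\<close> or \<open>l\<close>, as \<open>omit_root T t\<close> has that degree. The cases
are whether some \<open>m \<in> T\<close> is \<open>\<ge> 2\<close> and whether all four of \<open>-2, -1, 0, 1\<close> are in \<open>T\<close>.\<close>

theorem no_pair_transfer:
  fixes \<gamma> :: complex
  assumes large: "22 \<le> n \<or> n = 2 * b \<and> 16 \<le> n"
    and kl: "k < n" "l < n" "k \<noteq> l" and "\<tau> > 0"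
    and transfer: "\<And>t z. L z = (\<lambda>i. t * z i) \<Longrightarrow>
      cis (\<tau> * t) * of_real (inner_prod z (pair_vec k l)) = \<gamma> * of_real (inner_prod z y)"
  shows False
proof -
  have out: "\<forall>i\<ge>n. pair_vec k l i = 0" using kl by (simp add: pair_vec_def delta_def)
  have "kernel i j \<in> \<int>" for i j by (simp add: kernel_def cycle_graph_def)
  moreover have "pair_vec k l i \<in> \<int>" for i by (simp add: pair_vec_def delta_def)
  ultimately obtain T where T: "finite T" and mp: "min_poly (pair_vec k l) (\<Prod>s\<in>T. [:-s, 1:])"
    and gap: "\<And>s t. s \<in> T \<Longrightarrow> t \<in> T \<Longrightarrow> s \<noteq> t \<Longrightarrow> 1 \<le> \<bar>s - t\<bar>"
    and ints: "\<And>s t. s \<in> T \<Longrightarrow> t \<in> T \<Longrightarrow> s \<noteq> t \<Longrightarrow> \<bar>s - t\<bar> < 4 / 3 \<Longrightarrow> T \<subseteq> \<int>"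
    using transfer_support[OF _ out _ \<open>\<tau> > 0\<close> transfer] by blast
  define z where "z t = poly_op (omit_root T t) (pair_vec k l)" for t
  have Lz: "L (z t) = (\<lambda>i. t * z t i)" if "t \<in> T" for t
    unfolding z_def by (rule min_poly_cofactor_eigen(1)[OF out T mp that])
  have eig: "eigen t (per (z t))" if "t \<in> T" for t by (rule eigen_per[OF Lz[OF that]])
  have nz: "\<exists>u. per (z t) u \<noteq> 0" if t: "t \<in> T" for t
  proof -
    obtain i where "i < n" "z t i \<noteq> 0"
      using min_poly_cofactor_eigen(2)[OF out T mp t] unfolding z_def by blast
    then show ?thesis using per_of_nat[of i "z t"] by (intro exI[of _ "int i"]) simp
  qed
  have support: "reach (int k) j v \<or> reach (int l) j v"
    if t: "t \<in> T" and v: "per (z t) v \<noteq> 0" and j: "card T - 1 \<le> j" for t v j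
  proof -
    have "degree (omit_root T t) \<le> j" using degree_omit_root[OF T t] j by simp
    moreover have "per (poly_op (omit_root T t) (delta k)) v \<noteq> 0 \<or> per (poly_op (omit_root T t) (delta l)) v \<noteq> 0"
      using v unfolding z_def poly_op_pair by auto
    ultimately show ?thesis using reach_poly_op[OF kl(1)] reach_poly_op[OF kl(2)] by blast
  qed
  have lower: "-2 \<le> t" if "t \<in> T" for t
  proof (rule ccontr)
    assume "\<not> -2 \<le> t"
    then show False using eigen_le_minus2_alternating(1)[OF eig[OF that]] nz[OF that] by fastforce
  qed
  have top: "s = t" if st: "s \<in> T" "t \<in> T" "2 \<le> s" "2 \<le> t" for s t
  proof (rule ccontr)
    assume "s \<noteq> t"
    have sgn: "(\<forall>i<n. 0 < z u i) \<or> (\<forall>i<n. z u i < 0)" if "u \<in> T" "2 \<le> u" for u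
      using nz[OF that(1)] eigen_ge_2_positive[OF eig[OF that(1)] that(2)] per_of_nat[of _ "z u"] by metis
    have "inner_prod (z s) (z t) \<noteq> 0"
    proof -
      have "n > 0" using n3 by simp
      consider "\<forall>i<n. 0 < z s i * z t i" | "\<forall>i<n. z s i * z t i < 0"
        using sgn[OF st(1,3)] sgn[OF st(2,4)] by (auto simp: mult_pos_pos mult_neg_neg mult_neg_pos mult_pos_neg)
      then show ?thesis
      proof cases
        case 1
        then have "0 < inner_prod (z s) (z t)" unfolding inner_prod_def using \<open>n > 0\<close> by (intro sum_pos) auto
        then show ?thesis by simp
      next
        case 2
        then have "0 < (\<Sum>i<n. - (z s i * z t i))" using \<open>n > 0\<close> by (intro sum_pos) auto
        then show ?thesis by (simp add: inner_prod_def sum_negf)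
      qed
    qed
    then show False using eigen_orthogonal[OF Lz[OF st(1)] Lz[OF st(2)] \<open>s \<noteq> t\<close>] by simp
  qed
  have no33: "\<exists>v. \<not> reach (int k) 3 v \<and> \<not> reach (int l) 3 v"
    using no_cover_3_3[OF large] by blast
  define S where "S = {t \<in> T. t < 2}"
  have S: "S \<subseteq> T" "\<forall>s\<in>S. -2 \<le> s \<and> s < 2" using lower by (auto simp: S_def)
  have gapS: "\<forall>s\<in>S. \<forall>t\<in>S. s \<noteq> t \<longrightarrow> 1 \<le> \<bar>s - t\<bar>" using gap S(1) by blast
  note unit = unit_gap_set[OF gapS S(2)]
  have four: "S = {-2, -1, 0, 1}" if "card S = 4"
  proof -
    have "\<exists>s\<in>S. \<exists>t\<in>S. s \<noteq> t \<and> \<bar>s - t\<bar> < 4 / 3" by (rule unit(2)[OF that])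
    then have "T \<subseteq> \<int>" using ints S(1) by blast
    then show ?thesis using unit(3)[OF that] S(1) by blast
  qed
  show False
  proof (cases "\<exists>m\<in>T. 2 \<le> m")
    case True
    then obtain m where m: "m \<in> T" "2 \<le> m" by blast
    then have TS: "T - {m} = S" using top by (fastforce simp: S_def)
    then have cT: "card T - 1 = card S" using card_Diff_singleton[OF m(1)] by simp
    have zm: "(\<forall>v. 0 < per (z m) v) \<or> (\<forall>v. per (z m) v < 0)"
      using nz[OF m(1)] eigen_ge_2_positive[OF eig[OF m(1)] m(2)] by blast
    show False
    proof (cases "card S \<le> 3")
      case True
      then have "reach (int k) 3 v \<or> reach (int l) 3 v" for v
        using support[OF m(1), of v 3] zm cT by (metis less_irrefl)
      then show False using no33 by blast
    next
      case False
      then have S4: "S = {-2, -1, 0, 1}" using unit(1) four by simp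
      then have "-2 \<in> T" using S(1) by blast
      then obtain u where "per (z (-2)) u \<noteq> 0" using nz by blast
      \<comment> \<open>for a diameter this excludes \<open>n = 16\<close>, where \<open>b = 8\<close> would be even\<close>
      then have "even n" "odd b"
        using eigen_le_minus2_alternating(3,4)[OF eig[OF \<open>-2 \<in> T\<close>], of u] by simp_all
      then have large': "22 \<le> n \<or> n = 2 * b \<and> 18 \<le> n" using large by (cases "b = 8") auto
      have "omit_root T m = (\<Prod>s\<in>{-2, -1, 0, 1 :: real}. [:-s, 1:])"
        unfolding omit_root_def TS S4 ..
      also have "\<dots> = [:0, -2, -1, 2, 1:]" by simp
      finally have q: "omit_root T m = [:0, -2, -1, 2, 1:]" .
      have zq: "per (z m) v = per (poly_op [:0, -2, -1, 2, 1:] (delta k)) v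
          - per (poly_op [:0, -2, -1, 2, 1:] (delta l)) v" for v
        unfolding z_def q by (rule poly_op_pair)
      have zero: "per (poly_op [:0, -2, -1, 2, 1:] (delta a)) v = 0" if "a < n" "\<not> reach (int a) 4 v" for a v
        using reach_poly_op[OF that(1), of "[:0, -2, -1, 2, 1:]" 4 v] that(2) by auto
      from zm show False
      proof
        assume pos: "\<forall>v. 0 < per (z m) v"
        show False
        proof (rule no_cover_4_2[OF large', of "int k" "int l"], rule ccontr)
          fix v assume "\<not> (reach (int k) 4 v \<or> reach (int l) 2 v)"
          then have "per (z m) v \<le> 0"
            using zero[OF kl(1), of v] sign_polynomial_nonneg[OF kl(2), of v] by (simp add: zq)
          then show False using pos by (meson not_le)
        qed
      next
        assume neg: "\<forall>v. per (z m) v < 0"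
        show False
        proof (rule no_cover_4_2[OF large', of "int l" "int k"], rule ccontr)
          fix v assume "\<not> (reach (int l) 4 v \<or> reach (int k) 2 v)"
          then have "0 \<le> per (z m) v"
            using zero[OF kl(2), of v] sign_polynomial_nonneg[OF kl(1), of v] by (simp add: zq)
          then show False using neg by (meson not_le)
        qed
      qed
    qed
  next
    case False
    then have TS: "T = S" by (auto simp: S_def)
    show False
    proof (cases "card S \<le> 3")
      case True
      have "T \<noteq> {}"
      proof
        assume "T = {}"
        then have "pair_vec k l = (\<lambda>i. 0)" using mp by (simp add: min_poly_def)
        then have "pair_vec k l k = 0" by (rule fun_cong)
        then show False using kl(3) by (simp add: pair_vec_def delta_def)
      qed
      then obtain t where t: "t \<in> T" by blast
      have "reach (int k) 3 v \<or> reach (int l) 3 v" for v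
      proof -
        have supp: "reach (int k) 2 w \<or> reach (int l) 2 w" if "per (z t) w \<noteq> 0" for w
          using support[OF t that, of 2] True TS by simp
        have "per (z t) (v + 1) \<noteq> 0 \<or> per (z t) v \<noteq> 0"
          using eigen_two_zeros[OF eig[OF t], of v] nz[OF t] by blast
        then have "reach (int k) 2 (v + 1) \<or> reach (int l) 2 (v + 1) \<or> reach (int k) 2 v \<or> reach (int l) 2 v"
          using supp by blast
        then show ?thesis by (auto simp: numeral_3_eq_3 numeral_2_eq_2)
      qed
      then show False using no33 by blast
    next
      case False
      then have c4: "card S = 4" using unit(1) by simp
      then have t: "-2 \<in> T" using four TS by simp
      obtain u where u: "per (z (-2)) u \<noteq> 0" using nz[OF t] by blast
      have "reach (int k) 3 v \<or> reach (int l) 3 v" for v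
        using support[OF t, of v 3] eigen_le_minus2_alternating(2)[OF eig[OF t] _ u, of v] c4 TS by simp
      then show False using no33 by blast
    qed
  qed
qed

end

section \<open>From the matrix exponential to phases of eigenvectors\<close>

text \<open>The entries of \<open>M ^\<^sub>m m\<close> have absolute value at most \<open>C ^ m\<close>, where \<open>C\<close> is the sum of the absolute values of all entries of
\<open>M\<close>, so the exponential series of \<open>C\<close> is a majorant.\<close>

lemma mat_exp_sums:
  assumes M: "M \<in> carrier_mat n n" and ij: "i < n" "j < n"
  shows "(\<lambda>m. (M ^\<^sub>m m) $$ (i, j) / fact m) sums mat_exp M $$ (i, j)"
proof -
  define C where "C = (\<Sum>k<n. \<Sum>j<n. norm (M $$ (k, j)))"
  have bound: "norm ((M ^\<^sub>m m) $$ (i, j)) \<le> C ^ m" if "j < n" for m j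
    using that
  proof (induction m arbitrary: j)
    case 0
    then show ?case using ij M by simp
  next
    case (Suc m)
    have "(M ^\<^sub>m Suc m) $$ (i, j) = (\<Sum>k<n. (M ^\<^sub>m m) $$ (i, k) * M $$ (k, j))"
      using M ij Suc.prems by (simp add: scalar_prod_def atLeast0LessThan pow_carrier_mat[OF M, THEN carrier_matD(1)] pow_carrier_mat[OF M, THEN carrier_matD(2)])
    also have "norm \<dots> \<le> (\<Sum>k<n. norm ((M ^\<^sub>m m) $$ (i, k)) * norm (M $$ (k, j)))"
      by (rule order_trans[OF norm_sum]) (simp add: norm_mult)
    also have "\<dots> \<le> (\<Sum>k<n. C ^ m * norm (M $$ (k, j)))"
      using Suc.IH by (intro sum_mono mult_right_mono) auto
    also have "\<dots> = C ^ m * (\<Sum>k<n. norm (M $$ (k, j)))"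
      by (simp add: sum_distrib_left)
    also have "\<dots> \<le> C ^ m * C"
    proof (rule mult_left_mono)
      show "(\<Sum>k<n. norm (M $$ (k, j))) \<le> C" unfolding C_def
        using Suc.prems by (intro sum_mono member_le_sum[of j "{..<n}" "\<lambda>j. norm (M $$ (_, j))"]) auto
      show "0 \<le> C ^ m" by (simp add: C_def sum_nonneg)
    qed
    finally show ?case by (simp add: mult.commute)
  qed
  have "summable (\<lambda>m. (M ^\<^sub>m m) $$ (i, j) / fact m)"
  proof (rule summable_comparison_test')
    show "summable (\<lambda>m. C ^ m / fact m)"
      using summable_exp[of C] by (simp add: divide_inverse mult.commute)
    show "norm ((M ^\<^sub>m m) $$ (i, j) / fact m) \<le> C ^ m / fact m" if "0 \<le> m" for m
      using bound[OF ij(2), of m] by (simp add: norm_divide divide_right_mono)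
  qed
  then show ?thesis using ij M by (simp add: mat_exp_def summable_sums)
qed

lemma mat_exp_left_eigenvector:
  assumes M: "M \<in> carrier_mat n n" and j: "j < n"
    and z: "\<And>j. j < n \<Longrightarrow> (\<Sum>i<n. z i * M $$ (i, j)) = c * z j"
  shows "(\<Sum>i<n. z i * mat_exp M $$ (i, j)) = exp c * z j"
proof -
  have pow: "(\<Sum>i<n. z i * (M ^\<^sub>m m) $$ (i, j)) = c ^ m * z j" if "j < n" for m j
    using that
  proof (induction m arbitrary: j)
    case 0
    have "(\<Sum>i<n. z i * (M ^\<^sub>m 0) $$ (i, j)) = (\<Sum>i<n. if i = j then z i else 0)"
      using M 0 by (intro sum.cong) auto
    then show ?case using 0 by simp
  next
    case (Suc m)
    have "(\<Sum>i<n. z i * (M ^\<^sub>m Suc m) $$ (i, j)) =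
        (\<Sum>i<n. \<Sum>k<n. z i * ((M ^\<^sub>m m) $$ (i, k) * M $$ (k, j)))"
      using M Suc.prems by (intro sum.cong refl) (simp add: scalar_prod_def atLeast0LessThan sum_distrib_left
          pow_carrier_mat[OF M, THEN carrier_matD(1)] pow_carrier_mat[OF M, THEN carrier_matD(2)])
    also have "\<dots> = (\<Sum>k<n. \<Sum>i<n. z i * ((M ^\<^sub>m m) $$ (i, k) * M $$ (k, j)))"
      by (rule sum.swap)
    also have "\<dots> = (\<Sum>k<n. (\<Sum>i<n. z i * (M ^\<^sub>m m) $$ (i, k)) * M $$ (k, j))"
      by (simp add: sum_distrib_right mult.assoc)
    also have "\<dots> = (\<Sum>k<n. c ^ m * (z k * M $$ (k, j)))"
      using Suc.IH by (intro sum.cong) (auto simp: mult.assoc)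
    also have "\<dots> = c ^ Suc m * z j"
      using z[OF Suc.prems] by (simp add: sum_distrib_left[symmetric])
    finally show ?case .
  qed
  have "(\<lambda>m. \<Sum>i<n. z i * ((M ^\<^sub>m m) $$ (i, j) / fact m)) sums (\<Sum>i<n. z i * mat_exp M $$ (i, j))"
    using j by (intro sums_sum sums_mult mat_exp_sums[OF M]) auto
  moreover have "(\<Sum>i<n. z i * ((M ^\<^sub>m m) $$ (i, j) / fact m)) = c ^ m /\<^sub>R fact m * z j" for m
  proof -
    have "(\<Sum>i<n. z i * ((M ^\<^sub>m m) $$ (i, j) / fact m)) = (\<Sum>i<n. z i * (M ^\<^sub>m m) $$ (i, j)) / fact m"
      by (simp add: sum_divide_distrib)
    then show ?thesis by (simp add: pow[OF j] scaleR_conv_of_real field_simps)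
  qed
  moreover have "(\<lambda>m. c ^ m /\<^sub>R fact m * z j) sums (exp c * z j)"
    by (intro sums_mult2 exp_converges)
  ultimately show ?thesis using sums_unique2 by simp
qed

context chord_cycle
begin

abbreviation Q :: "real mat" where
  "Q \<equiv> signless_laplacian n (add_edge (cycle_graph n) (real \<rho>) 0 b)"

lemma cycle_graph_row_sum:
  assumes "i < n"
  shows "(\<Sum>j<n. cycle_graph n i j) = 2"
proof -
  have "per (L (\<lambda>_. 1)) (int i) = (\<Sum>j<n. kernel i j)"
    using assms by (simp add: per_of_nat L_def)
  also have "\<dots> = (\<Sum>j<n. cycle_graph n i j) + (\<Sum>j<n. if i \<in> {0, b} \<and> j \<in> {0, b} then real \<rho> else 0)"
    by (simp only: kernel_def sum.distrib)
  also have "(\<Sum>j<n. if i \<in> {0, b} \<and> j \<in> {0, b} then real \<rho> else 0) =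
      (if i \<in> {0, b} then 2 * real \<rho> else 0)"
  proof -
    have "(\<Sum>j<n. if j \<in> {0, b} then real \<rho> else 0) = (\<Sum>j\<in>{0, b}. real \<rho>)"
      by (rule sum.mono_neutral_cong_right) (use bn in auto)
    then show ?thesis using b0 by auto
  qed
  finally show ?thesis using assms by (simp add: per_L mark_iff) (simp add: per_def split: if_splits)
qed

lemma chord_row_sum:
  assumes "i < n"
  shows "(\<Sum>j<n. if {i, j} = {0, b} then real \<rho> else 0) = (if i \<in> {0, b} then real \<rho> else 0)"
proof -
  have "(\<Sum>j<n. if {i, j} = {0, b} then real \<rho> else 0) =
      (\<Sum>j<n. if j = (if i = 0 then b else 0) then (if i \<in> {0, b} then real \<rho> else 0) else 0)"
    using b0 by (intro sum.cong) (auto simp: doubleton_eq_iff)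
  also have "\<dots> = (if i \<in> {0, b} then real \<rho> else 0)" using b0 bn by simp
  finally show ?thesis .
qed

lemma Q_carrier: "Q \<in> carrier_mat n n"
  by (simp add: signless_laplacian_def row_sum_matrix_def adjacency_matrix_def mat_diag_def)

lemma Q_entry:
  assumes "i < n" "j < n"
  shows "Q $$ (i, j) = kernel i j + (if i = j then 2 else 0)"
proof -
  have "(\<Sum>j<n. add_edge (cycle_graph n) (real \<rho>) 0 b i j) = 2 + (if i \<in> {0, b} then real \<rho> else 0)"
    using assms(1) by (simp only: add_edge_def sum.distrib cycle_graph_row_sum chord_row_sum)
  moreover have "Q $$ (i, j) = (if i = j then \<Sum>j<n. add_edge (cycle_graph n) (real \<rho>) 0 b i j else 0)
      + add_edge (cycle_graph n) (real \<rho>) 0 b i j"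
    using assms by (simp add: signless_laplacian_def row_sum_matrix_def adjacency_matrix_def mat_diag_def)
  ultimately have "Q $$ (i, j) = (if i = j then 2 + (if i \<in> {0, b} then real \<rho> else 0) else 0)
      + (cycle_graph n i j + (if {i, j} = {0, b} then real \<rho> else 0))"
    by (simp only: add_edge_def)
  also have "\<dots> = kernel i j + (if i = j then 2 else 0)"
    using b0 by (auto simp: kernel_def doubleton_eq_iff)
  finally show ?thesis .
qed

lemma Q_left_eigenvector:
  assumes "L z = (\<lambda>i. t * z i)" and "j < n"
  shows "(\<Sum>i<n. z i * Q $$ (i, j)) = (t + 2) * z j"
proof -
  have "(\<Sum>i<n. z i * Q $$ (i, j)) = (\<Sum>i<n. kernel j i * z i + (if i = j then 2 * z i else 0))"
    using assms(2) by (intro sum.cong refl) (simp add: Q_entry symm algebra_simps)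
  also have "\<dots> = L z j + 2 * z j"
    using assms(2) by (simp add: sum.distrib L_def)
  finally show ?thesis using assms(1) by (simp add: algebra_simps)
qed

lemma inner_prod_pair:
  assumes "k < n" "l < n"
  shows "(\<Sum>i<n. complex_of_real (z i) * pair_state n k l $ i)
    = of_real (1 / sqrt 2) * of_real (inner_prod z (pair_vec k l))"
proof -
  have "(\<Sum>i<n. complex_of_real (z i) * pair_state n k l $ i)
      = (\<Sum>i<n. of_real (1 / sqrt 2) * of_real (z i * pair_vec k l i))"
    using assms by (intro sum.cong refl) (auto simp: pair_state_def pair_vec_def delta_def unit_vec_def)
  then show ?thesis by (simp add: inner_prod_def sum_distrib_left)
qed

text \<open>Pairing both sides of the transfer equation with the eigenvector \<open>z\<close> turns the matrix exponential into the
scalar \<open>exp (\<i> \<tau> (t + 2))\<close>. The factor \<open>exp (2 \<i> \<tau>)\<close> comes from the shift by 2 and does not depend on \<open>z\<close>,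
so it can be absorbed into \<open>\<gamma>\<close>.\<close>

lemma transfer_phase:
  assumes kl: "k < n" "l < n" "k' < n" "l' < n"
    and transfer: "mat_exp ((\<i> * complex_of_real \<tau>) \<cdot>\<^sub>m map_mat complex_of_real Q) *\<^sub>v pair_state n k l
      = \<gamma> \<cdot>\<^sub>v pair_state n k' l'"
    and z: "L z = (\<lambda>i. t * z i)"
  shows "cis (\<tau> * t) * of_real (inner_prod z (pair_vec k l)) = (\<gamma> * cis (- 2 * \<tau>)) * of_real (inner_prod z (pair_vec k' l'))"
proof -
  define M where "M = (\<i> * complex_of_real \<tau>) \<cdot>\<^sub>m map_mat complex_of_real Q"
  have M: "M \<in> carrier_mat n n" using Q_carrier by (simp add: M_def)
  define c where "c = \<i> * complex_of_real (\<tau> * (t + 2))"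
  have row: "(\<Sum>i<n. complex_of_real (z i) * M $$ (i, j)) = c * of_real (z j)" if "j < n" for j
  proof -
    have "(\<Sum>i<n. complex_of_real (z i) * M $$ (i, j)) = \<i> * of_real \<tau> * of_real (\<Sum>i<n. z i * Q $$ (i, j))"
      using that Q_carrier by (simp add: M_def sum_distrib_left mult_ac)
    then show ?thesis unfolding Q_left_eigenvector[OF z that] by (simp add: c_def algebra_simps)
  qed
  have dims: "dim_row (mat_exp M) = n" "dim_col (mat_exp M) = n" using M by (simp_all add: mat_exp_def)
  have dimp: "dim_vec (pair_state n k l) = n" "dim_vec (pair_state n k' l') = n" by (simp_all add: pair_state_def)
  have "\<gamma> * (\<Sum>i<n. complex_of_real (z i) * pair_state n k' l' $ i)
      = (\<Sum>i<n. complex_of_real (z i) * (\<gamma> \<cdot>\<^sub>v pair_state n k' l') $ i)"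
    using dimp by (simp add: sum_distrib_left mult_ac)
  also have "\<dots> = (\<Sum>i<n. complex_of_real (z i) * (mat_exp M *\<^sub>v pair_state n k l) $ i)"
    using transfer by (simp add: M_def)
  also have "\<dots> = (\<Sum>i<n. \<Sum>j<n. complex_of_real (z i) * (mat_exp M $$ (i, j) * pair_state n k l $ j))"
    using dims dimp by (intro sum.cong refl) (simp add: scalar_prod_def atLeast0LessThan sum_distrib_left)
  also have "\<dots> = (\<Sum>j<n. \<Sum>i<n. complex_of_real (z i) * (mat_exp M $$ (i, j) * pair_state n k l $ j))"
    by (rule sum.swap)
  also have "\<dots> = (\<Sum>j<n. (\<Sum>i<n. complex_of_real (z i) * mat_exp M $$ (i, j)) * pair_state n k l $ j)"
    by (simp add: sum_distrib_right mult.assoc)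
  also have "\<dots> = (\<Sum>j<n. exp c * (of_real (z j) * pair_state n k l $ j))"
    using mat_exp_left_eigenvector[OF M _ row] by (intro sum.cong refl) (simp add: mult.assoc)
  also have "\<dots> = exp c * (\<Sum>j<n. complex_of_real (z j) * pair_state n k l $ j)"
    by (simp add: sum_distrib_left)
  finally have "\<gamma> * of_real (inner_prod z (pair_vec k' l')) = exp c * of_real (inner_prod z (pair_vec k l))"
    unfolding inner_prod_pair[OF kl(1,2)] inner_prod_pair[OF kl(3,4)] by simp
  moreover have "exp c = cis (2 * \<tau>) * cis (\<tau> * t)"
    by (simp add: c_def cis_conv_exp exp_add[symmetric] algebra_simps)
  ultimately have "cis (- 2 * \<tau>) * (\<gamma> * of_real (inner_prod z (pair_vec k' l')))
      = (cis (- 2 * \<tau>) * cis (2 * \<tau>)) * (cis (\<tau> * t) * of_real (inner_prod z (pair_vec k l)))"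
    by (simp only: mult.assoc)
  then show ?thesis by (simp add: cis_mult mult_ac)
qed

end

theorem theorem5:
  fixes n b \<rho> :: nat
  assumes "0 < \<rho>" and "0 < b" and "b < n"
  shows "(real b = real n / 2 \<and> 16 \<le> n \<longrightarrow>
            \<not> perfect_pair_state_transfer n
                (signless_laplacian n (add_edge (cycle_graph n) (real \<rho>) 0 b))) \<and>
         (real b \<noteq> real n / 2 \<and> 22 \<le> n \<longrightarrow>
            \<not> perfect_pair_state_transfer n
                (signless_laplacian n (add_edge (cycle_graph n) (real \<rho>) 0 b)))"
proof -
  have "\<not> perfect_pair_state_transfer n (signless_laplacian n (add_edge (cycle_graph n) (real \<rho>) 0 b))"
    if large: "22 \<le> n \<or> n = 2 * b \<and> 16 \<le> n"
  proof
    interpret chord_cycle n b \<rho> using assms large by unfold_locales auto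
    assume "perfect_pair_state_transfer n Q"
    then obtain k l k' l' \<tau> \<gamma> where "k < n" "l < n" "k \<noteq> l" "k' < n" "l' < n" "0 < \<tau>"
      and "mat_exp ((\<i> * complex_of_real \<tau>) \<cdot>\<^sub>m map_mat complex_of_real Q) *\<^sub>v pair_state n k l
        = \<gamma> \<cdot>\<^sub>v pair_state n k' l'"
      unfolding perfect_pair_state_transfer_def is_pair_state_def by blast
    then show False
      using no_pair_transfer[OF large _ _ _ _ transfer_phase] by blast
  qed
  moreover have "n = 2 * b" if "real b = real n / 2" using that by linarith
  ultimately show ?thesis by blast
qed

end
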